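(* Let $X$ be a Hadamard space, and let $c$ be a weighted configuration on $\partial_\infty X$ which is stable on the ultraproduct $X^\omega$ (i.e. $c$, regarded as a weighted configuration on $\partial_\infty X^\omega$ via the canonical embedding $X\subset X^\omega$, is stable). Then the associated weak contraction $\Phi_c:X\to X$ has a fixed point. In particular, there exists a polygon $p$ in $X$ such that $c$ is a Gauss map for $p$.
   Context: A Hadamard space is a complete CAT(0) space. Rays have unit speed. $\partial_\infty X$ is the set of equivalence classes of rays, two rays being equivalent if they have bounded distance. For $x\in X$, $\xi\in\partial_\infty X$, $\overline{x\xi}$ is the unique ray from $x$ in the class $\xi$ and $\overline{x\xi}(t)$ its point at distance $t$ from $x$. $\angle(\xi,\eta)\in[0,\pi]$ is the Tits angle, $\angle(\xi,\eta)=\lim_{t,t'\to\infty}\tilde\angle_o(\overline{o\xi}(t),\overline{o\eta}(t'))$, where $\tilde\angle_o$ is the Euclidean comparison angle at $o$ (independent of $o$). A weighted configuration $c$ on the boundary $\partial_\infty Y$ of a Hadamard space $Y$ is an $n$-tuple $(\xi_1,\dots,\xi_n)$ of points of $\partial_\infty Y$ together with weights $m_1,\dots,m_n\in\mathbb{R}_{>0}$. Its slope function is $\mathrm{slope}_c(\xi)=-\sum_{i=1}^n m_i\cos\angle(\xi_i,\xi)$, $\xi\in\partial_\infty Y$; $c$ is stable if $\mathrm{slope}_c>0$ on $\partial_\infty Y$. For $\xi\in\partial_\infty X$, $t\ge0$ put $\phi_{\xi,t}(x)=\overline{x\xi}(t)$, and $\Phi_c=\phi_{\xi_n,m_n}\circ\dots\circ\phi_{\xi_1,m_1}:X\to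 X$ (1-Lipschitz). A polygon $p$ in $X$ is an $n$-tuple $(x_1,\dots,x_n)$ of points of $X$ with $x_i\ne x_{i+1}$ for all $i\in\mathbb{Z}/n\mathbb{Z}$. A weighted configuration $c$ with points $\xi_i$ and weights $m_i$ is a Gauss map for $p$ if for all $i$ (indices mod $n$) $x_{i+1}\in\overline{x_i\xi_i}$ and $m_i=d(x_i,x_{i+1})$. Ultraproduct: $\omega$ is a fixed non-principal ultrafilter on $\mathbb{N}$. For a basepoint $o\in X$, $X^\omega$ is the ultralimit of the constant sequence $(X,d,o)$: the set of sequences $(x_i)$ in $X$ with $d(x_i,o)$ bounded, with distance $\lim_\omega d(x_i,y_i)$, modulo identification of sequences at distance zero (independent of $o$). It is a Hadamard space, and $x\mapsto(x,x,\dots)$ is the canonical isometric embedding $X\to X^\omega$, which induces an inclusion $\partial_\infty X\subset\partial_\infty X^\omega$. *)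

theory Defs
  imports "HOL-Analysis.Analysis"
begin

text \<open>Metric spaces are given by a carrier \<open>M\<close> and a distance \<open>d\<close> (locale \<^locale>\<open>Metric_space\<close>), so that
  a space and its ultralimit, whose points are equivalence classes of sequences, are treated by
  the same definitions.\<close>

section \<open>Hadamard spaces\<close>

definition geodesic_segment :: "'a set \<Rightarrow> ('a \<Rightarrow> 'a \<Rightarrow> real) \<Rightarrow> 'a \<Rightarrow> 'a \<Rightarrow> 'a set \<Rightarrow> bool" where
  "geodesic_segment M d x y S \<longleftrightarrow>
     (\<exists>\<gamma>. \<gamma> \<in> {0..d x y} \<rightarrow> M \<and> \<gamma> 0 = x \<and> \<gamma> (d x y) = y \<and>
          (\<forall>s\<in>{0..d x y}. \<forall>t\<in>{0..d x y}. d (\<gamma> s) (\<gamma> t) = \<bar>s - t\<bar>) \<and>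
          S = \<gamma> ` {0..d x y})"

text \<open>The comparison points \<open>p'\<close> and \<open>q'\<close> lie on the sides of a Euclidean comparison triangle
  \<open>x' y' z'\<close>. As \<open>x, y, z\<close> range over all labellings of the vertices, it is enough to take \<open>p\<close> and
  \<open>q\<close> on the two sides issuing from \<open>x\<close>.\<close>

definition CAT0 :: "'a set \<Rightarrow> ('a \<Rightarrow> 'a \<Rightarrow> real) \<Rightarrow> bool" where
  "CAT0 M d \<longleftrightarrow>
     (\<forall>x\<in>M. \<forall>y\<in>M. \<exists>S. geodesic_segment M d x y S) \<and>
     (\<forall>x\<in>M. \<forall>y\<in>M. \<forall>z\<in>M. \<forall>S T.
        geodesic_segment M d x y S \<longrightarrow> geodesic_segment M d x z T \<longrightarrow>
        (\<forall>p\<in>S. \<forall>q\<in>T. \<forall>x' y' z' p' q' :: real^2.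
           dist x' y' = d x y \<longrightarrow> dist y' z' = d y z \<longrightarrow> dist x' z' = d x z \<longrightarrow>
           p' \<in> closed_segment x' y' \<longrightarrow> dist x' p' = d x p \<longrightarrow>
           q' \<in> closed_segment x' z' \<longrightarrow> dist x' q' = d x q \<longrightarrow>
           d p q \<le> dist p' q'))"

definition Hadamard_space :: "'a set \<Rightarrow> ('a \<Rightarrow> 'a \<Rightarrow> real) \<Rightarrow> bool" where
  "Hadamard_space M d \<longleftrightarrow> Metric_space M d \<and> Metric_space.mcomplete M d \<and> CAT0 M d"


section \<open>Boundary at infinity\<close>

text \<open>Rays are functions on \<open>[0,\<infinity>)\<close>, extended by \<open>undefined\<close> to negative arguments; this makes the
  ray from a given point in a given class unique as a function on all of \<open>real\<close>.\<close>

definition rays :: "'a set \<Rightarrow> ('a \<Rightarrow> 'a \<Rightarrow> real) \<Rightarrow> (real \<Rightarrow> 'a) set" where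
  "rays M d = {r \<in> {0..} \<rightarrow>\<^sub>E M. \<forall>s\<ge>0. \<forall>t\<ge>0. d (r s) (r t) = \<bar>s - t\<bar>}"

definition asymptotic :: "'a set \<Rightarrow> ('a \<Rightarrow> 'a \<Rightarrow> real) \<Rightarrow> ((real \<Rightarrow> 'a) \<times> (real \<Rightarrow> 'a)) set" where
  "asymptotic M d =
     {(r, r'). r \<in> rays M d \<and> r' \<in> rays M d \<and> (\<exists>C. \<forall>t\<ge>0. d (r t) (r' t) \<le> C)}"

definition boundary :: "'a set \<Rightarrow> ('a \<Rightarrow> 'a \<Rightarrow> real) \<Rightarrow> (real \<Rightarrow> 'a) set set" where
  "boundary M d = rays M d // asymptotic M d"

definition ray_from :: "'a \<Rightarrow> (real \<Rightarrow> 'a) set \<Rightarrow> real \<Rightarrow> 'a" where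
  "ray_from x \<xi> = (THE r. r \<in> \<xi> \<and> r 0 = x)"

definition comparison_angle :: "('a \<Rightarrow> 'a \<Rightarrow> real) \<Rightarrow> 'a \<Rightarrow> 'a \<Rightarrow> 'a \<Rightarrow> real" where
  "comparison_angle d b x y =
     arccos (((d b x)\<^sup>2 + (d b y)\<^sup>2 - (d x y)\<^sup>2) / (2 * d b x * d b y))"

text \<open>In a nonempty Hadamard space the limit exists and does not depend on the base point \<open>b\<close>.\<close>

definition tits_angle ::
  "'a set \<Rightarrow> ('a \<Rightarrow> 'a \<Rightarrow> real) \<Rightarrow> (real \<Rightarrow> 'a) set \<Rightarrow> (real \<Rightarrow> 'a) set \<Rightarrow> real" where
  "tits_angle M d \<xi> \<eta> =
     (THE \<alpha>. \<forall>b\<in>M. ((\<lambda>(t, t'). comparison_angle d b (ray_from b \<xi> t) (ray_from b \<eta> t')) \<longlongrightarrow> \<alpha>)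
                     (at_top \<times>\<^sub>F at_top))"


section \<open>Weighted configurations\<close>

text \<open>A configuration is the list of the pairs \<open>(\<xi>\<^sub>i, m\<^sub>i)\<close>, and a polygon is the list of its vertices.\<close>

type_synonym 'a wconfig = "((real \<Rightarrow> 'a) set \<times> real) list"

definition weighted_config :: "'a set \<Rightarrow> ('a \<Rightarrow> 'a \<Rightarrow> real) \<Rightarrow> 'a wconfig \<Rightarrow> bool" where
  "weighted_config M d c \<longleftrightarrow> (\<forall>(\<xi>, m)\<in>set c. \<xi> \<in> boundary M d \<and> m > 0)"

definition slope :: "'a set \<Rightarrow> ('a \<Rightarrow> 'a \<Rightarrow> real) \<Rightarrow> 'a wconfig \<Rightarrow> (real \<Rightarrow> 'a) set \<Rightarrow> real" where
  "slope M d c \<xi> = - (\<Sum>(\<xi>', m)\<leftarrow>c. m * cos (tits_angle M d \<xi>' \<xi>))"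

definition stable_config :: "'a set \<Rightarrow> ('a \<Rightarrow> 'a \<Rightarrow> real) \<Rightarrow> 'a wconfig \<Rightarrow> bool" where
  "stable_config M d c \<longleftrightarrow> (\<forall>\<xi>\<in>boundary M d. slope M d c \<xi> > 0)"

definition push :: "(real \<Rightarrow> 'a) set \<Rightarrow> real \<Rightarrow> 'a \<Rightarrow> 'a" where
  "push \<xi> t x = ray_from x \<xi> t"

text \<open>\<^const>\<open>fold\<close> applies the map belonging to the head of the list first.\<close>

definition weak_contraction :: "'a wconfig \<Rightarrow> 'a \<Rightarrow> 'a" where
  "weak_contraction c = fold (\<lambda>(\<xi>, m). push \<xi> m) c"

definition polygon :: "'a set \<Rightarrow> 'a list \<Rightarrow> bool" where
  "polygon M p \<longleftrightarrow> set p \<subseteq> M \<and> (\<forall>i<length p. p ! i \<noteq> p ! (Suc i mod length p))"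

definition gauss_map :: "('a \<Rightarrow> 'a \<Rightarrow> real) \<Rightarrow> 'a wconfig \<Rightarrow> 'a list \<Rightarrow> bool" where
  "gauss_map d c p \<longleftrightarrow> length c = length p \<and>
     (\<forall>i<length p. p ! (Suc i mod length p) \<in> ray_from (p ! i) (fst (c ! i)) ` {0..} \<and>
                   snd (c ! i) = d (p ! i) (p ! (Suc i mod length p)))"


section \<open>Ultralimits of constant sequences\<close>

definition nonprincipal_ultrafilter :: "nat filter \<Rightarrow> bool" where
  "nonprincipal_ultrafilter \<omega> \<longleftrightarrow>
     \<omega> \<noteq> bot \<and> (\<forall>P. eventually P \<omega> \<or> eventually (\<lambda>n. \<not> P n) \<omega>) \<and> (\<forall>n. \<omega> \<noteq> principal {n})"

definition bounded_seqs :: "'a set \<Rightarrow> ('a \<Rightarrow> 'a \<Rightarrow> real) \<Rightarrow> 'a \<Rightarrow> (nat \<Rightarrow> 'a) set" where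
  "bounded_seqs M d b = {u. range u \<subseteq> M \<and> (\<exists>C. \<forall>n. d (u n) b \<le> C)}"

definition ultra_rel ::
  "'a set \<Rightarrow> ('a \<Rightarrow> 'a \<Rightarrow> real) \<Rightarrow> 'a \<Rightarrow> nat filter \<Rightarrow> ((nat \<Rightarrow> 'a) \<times> (nat \<Rightarrow> 'a)) set" where
  "ultra_rel M d b \<omega> =
     {(u, v). u \<in> bounded_seqs M d b \<and> v \<in> bounded_seqs M d b \<and> ((\<lambda>n. d (u n) (v n)) \<longlongrightarrow> 0) \<omega>}"

definition ultra_space ::
  "'a set \<Rightarrow> ('a \<Rightarrow> 'a \<Rightarrow> real) \<Rightarrow> 'a \<Rightarrow> nat filter \<Rightarrow> (nat \<Rightarrow> 'a) set set" where
  "ultra_space M d b \<omega> = bounded_seqs M d b // ultra_rel M d b \<omega>"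

text \<open>The value \<open>0\<close> outside the carrier only serves the locale \<^locale>\<open>Metric_space\<close>, which demands that
  distances be nonnegative and symmetric on the whole type.\<close>

definition ultra_dist ::
  "'a set \<Rightarrow> ('a \<Rightarrow> 'a \<Rightarrow> real) \<Rightarrow> 'a \<Rightarrow> nat filter \<Rightarrow> (nat \<Rightarrow> 'a) set \<Rightarrow> (nat \<Rightarrow> 'a) set \<Rightarrow> real" where
  "ultra_dist M d b \<omega> U V =
     (if U \<in> ultra_space M d b \<omega> \<and> V \<in> ultra_space M d b \<omega>
      then THE l. \<forall>u\<in>U. \<forall>v\<in>V. ((\<lambda>n. d (u n) (v n)) \<longlongrightarrow> l) \<omega> else 0)"

definition ultra_embed ::
  "'a set \<Rightarrow> ('a \<Rightarrow> 'a \<Rightarrow> real) \<Rightarrow> 'a \<Rightarrow> nat filter \<Rightarrow> 'a \<Rightarrow> (nat \<Rightarrow> 'a) set" where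
  "ultra_embed M d b \<omega> x = ultra_rel M d b \<omega> `` {\<lambda>_. x}"

text \<open>For an isometric embedding \<open>f\<close> into the space \<open>(N, e)\<close>, the images under \<open>f\<close> of the rays in \<open>\<xi>\<close> are
  mutually asymptotic rays, so that the relational image below is a single class.\<close>

definition boundary_map ::
  "'b set \<Rightarrow> ('b \<Rightarrow> 'b \<Rightarrow> real) \<Rightarrow> ('a \<Rightarrow> 'b) \<Rightarrow> (real \<Rightarrow> 'a) set \<Rightarrow> (real \<Rightarrow> 'b) set" where
  "boundary_map N e f \<xi> = asymptotic N e `` ((\<lambda>r. restrict (f \<circ> r) {0..}) ` \<xi>)"

definition ultra_config ::
  "'a set \<Rightarrow> ('a \<Rightarrow> 'a \<Rightarrow> real) \<Rightarrow> 'a \<Rightarrow> nat filter \<Rightarrow> 'a wconfig \<Rightarrow> (nat \<Rightarrow> 'a) set wconfig" where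
  "ultra_config M d b \<omega> c =
     map (\<lambda>(\<xi>, m).
            (boundary_map (ultra_space M d b \<omega>) (ultra_dist M d b \<omega>) (ultra_embed M d b \<omega>) \<xi>, m)) c"

end

theory Submission
  imports Defs
begin

text \<open>Stewart's inequality characterises the \<open>CAT(0)\<close> condition and passes to ultralimits. A 1-Lipschitz
  self-map of a Hadamard space with a bounded orbit fixes the asymptotic centre of that orbit. So if
  \<open>\<Phi>\<^sub>c\<close> has no fixed point, its orbits are unbounded, and there are points \<open>x\<^sub>k\<close> with
  \<open>D\<^sub>k = d(b, x\<^sub>k) \<rightarrow> \<infinity>\<close> and \<open>d(b, \<Phi>\<^sub>c x\<^sub>k) \<ge> d(b, x\<^sub>k)\<close>. The segments from \<open>b\<close> to \<open>x\<^sub>k\<close> converge to a ray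
  of \<open>X\<^sup>\<omega>\<close> in a class \<open>\<eta>\<close>. Let \<open>\<theta>\<^sub>i(k)\<close> be the comparison angle at \<open>b\<close> of \<open>x\<^sub>k\<close> and the point at distance
  \<open>D\<^sub>k\<close> on the ray from \<open>b\<close> to \<open>\<xi>\<^sub>i\<close>. The quadrilateral inequality bounds the change of \<open>d(b, \<cdot>)\<^sup>2\<close> along
  \<open>\<Phi>\<^sub>c\<close> at \<open>x\<^sub>k\<close> by \<open>2 D\<^sub>k \<Sum> m\<^sub>i cos \<theta>\<^sub>i(k) + O(1)\<close>, so the limit of \<open>\<Sum> m\<^sub>i cos \<theta>\<^sub>i(k)\<close> along \<open>\<omega>\<close> is
  nonnegative. By monotonicity of comparison angles \<open>cos \<angle>(\<xi>\<^sub>i, \<eta>)\<close> is at least the limit of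
  \<open>cos \<theta>\<^sub>i(k)\<close>. Hence the slope of \<open>c\<close> at \<open>\<eta>\<close> is not positive.\<close>

section \<open>Stewart's inequality\<close>

text \<open>The inequality compares the point dividing \<open>x y\<close> at the fraction
  \<open>l\<close> with any third point \<open>z\<close>. It speaks of distances and a single
  existential point, not of geodesics or comparison triangles, and so survives a limit taken entry
  by entry.\<close>

locale hadamard = Metric_space M d for M :: "'a set" and d +
  assumes complete: mcomplete
    and stewart_point: "\<lbrakk>x \<in> M; y \<in> M; 0 \<le> l; l \<le> 1\<rbrakk> \<Longrightarrow>
      \<exists>p\<in>M. \<forall>z\<in>M. (d z p)\<^sup>2 \<le> (1 - l) * (d z x)\<^sup>2 + l * (d z y)\<^sup>2 - l * (1 - l) * (d x y)\<^sup>2"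

text \<open>One side is placed on the first axis. The law of cosines gives the first coordinate
  \<open>u\<close> of the third vertex, and the triangle inequalities yield
  \<open>u\<^sup>2 \<le> B\<^sup>2\<close>, so that the second coordinate is real.\<close>

lemma comparison_triangle:
  fixes A B C :: real
  assumes "0 \<le> A" "0 \<le> B" "0 \<le> C" "A \<le> B + C" "B \<le> A + C" "C \<le> A + B"
  obtains x y z :: "real^2" where "dist x y = A" "dist y z = C" "dist x z = B"
proof (cases "A = 0")
  case True
  then have "B = C" using assms by simp
  moreover have "dist (0::real^2) (B *\<^sub>R axis 1 1) = B"
    using assms by simp
  ultimately show ?thesis
    using True that[of 0 0 "B *\<^sub>R axis 1 1"] by simp
next
  case False
  then have A: "A > 0" using assms by simp
  define u where "u = (A\<^sup>2 + B\<^sup>2 - C\<^sup>2) / (2 * A)"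
  have uA: "2 * A * u = A\<^sup>2 + B\<^sup>2 - C\<^sup>2" using A by (simp add: u_def)
  have "(A - B)\<^sup>2 \<le> C\<^sup>2"
    using assms by (intro power2_le_iff_abs_le[THEN iffD2]) auto
  moreover have "C\<^sup>2 \<le> (A + B)\<^sup>2" using assms by (simp add: power_mono)
  ultimately have "2 * A * u \<le> 2 * A * B" "2 * A * (-B) \<le> 2 * A * u"
    unfolding uA by (auto simp: power2_eq_square algebra_simps)
  then have "u \<le> B" "- B \<le> u"
    using mult_left_le_imp_le[of "2 * A" u B] mult_left_le_imp_le[of "2 * A" "-B" u] A
    by linarith+
  then have "u\<^sup>2 \<le> B\<^sup>2" using assms by (simp add: power2_le_iff_abs_le abs_le_iff)
  then have v: "(sqrt (B\<^sup>2 - u\<^sup>2))\<^sup>2 = B\<^sup>2 - u\<^sup>2" by simp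
  let ?y = "vector [A, 0] :: real^2" and ?z = "vector [u, sqrt (B\<^sup>2 - u\<^sup>2)] :: real^2"
  show ?thesis
  proof (rule that[of 0 ?y ?z])
    show "dist 0 ?y = A"
      using A by (simp add: norm_eq_sqrt_inner inner_vec_def sum_2)
    have "norm ?z = sqrt (B\<^sup>2)"
      by (simp add: norm_eq_sqrt_inner inner_vec_def sum_2 v flip: power2_eq_square)
    then show "dist 0 ?z = B" using assms by simp
    have "(A - u)\<^sup>2 + (B\<^sup>2 - u\<^sup>2) = C\<^sup>2"
      using uA by (simp add: power2_eq_square algebra_simps)
    then have "norm (?y - ?z) = sqrt (C\<^sup>2)"
      by (simp add: norm_eq_sqrt_inner inner_vec_def sum_2 v flip: power2_eq_square)
    then show "dist ?y ?z = C" using assms by (simp add: dist_norm)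
  qed
qed

text \<open>The square of the norm of \<open>(1 - l) *\<^sub>R u + l *\<^sub>R v\<close> is
  expanded, with \<open>z\<close> as origin. Under comparison this identity weakens to the
  inequality of the locale \<open>hadamard\<close>.\<close>

lemma euclidean_stewart:
  fixes x y z :: "'v::real_inner"
  shows "(dist (x + l *\<^sub>R (y - x)) z)\<^sup>2
    = (1 - l) * (dist z x)\<^sup>2 + l * (dist z y)\<^sup>2 - l * (1 - l) * (dist x y)\<^sup>2"
proof -
  define u where "u = x - z"
  define v where "v = y - z"
  have "x + l *\<^sub>R (y - x) - z = (1 - l) *\<^sub>R u + l *\<^sub>R v" "x - y = u - v"
    by (simp_all add: u_def v_def algebra_simps)
  then have eq: "dist (x + l *\<^sub>R (y - x)) z = norm ((1 - l) *\<^sub>R u + l *\<^sub>R v)"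
    "dist z x = norm u" "dist z y = norm v" "dist x y = norm (u - v)"
    by (simp_all add: dist_norm norm_minus_commute u_def v_def)
  show ?thesis
    unfolding eq power2_norm_eq_inner
    by (simp add: inner_add_left inner_add_right inner_diff_left inner_diff_right inner_commute[of v u])
       (simp add: algebra_simps)
qed

lemma hadamard_if_Hadamard_space:
  assumes "Hadamard_space M d"
  shows "hadamard M d"
proof -
  interpret Metric_space M d using assms by (simp add: Hadamard_space_def)
  have cat: "CAT0 M d" and comp: mcomplete using assms by (auto simp: Hadamard_space_def)
  have geod: "\<exists>S. geodesic_segment M d x y S" if "x \<in> M" "y \<in> M" for x y
    using cat[unfolded CAT0_def, THEN conjunct1] that by simp
  have cat_ineq: "d p q \<le> dist p' q'"
    if "x \<in> M" "y \<in> M" "z \<in> M" "geodesic_segment M d x y S" "geodesic_segment M d x z T" "p \<in> S" "q \<in> T"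
      "dist x' y' = d x y" "dist y' z' = d y z" "dist x' z' = d x z"
      "p' \<in> closed_segment x' y'" "dist x' p' = d x p" "q' \<in> closed_segment x' z'" "dist x' q' = d x q"
    for x y z p q S T and x' y' z' p' q' :: "real^2"
    using cat[unfolded CAT0_def, THEN conjunct2, rule_format, of x y z S T p q x' y' z' p' q'] that by simp
  show ?thesis
  proof (unfold_locales, rule comp)
    fix x y :: 'a and l :: real
    assume xy: "x \<in> M" "y \<in> M" and l: "0 \<le> l" "l \<le> 1"
    obtain S where S: "geodesic_segment M d x y S"
      using geod xy by blast
    then obtain g where g: "g \<in> {0..d x y} \<rightarrow> M" "g 0 = x" "S = g ` {0..d x y}"
      "\<And>s t. s\<in>{0..d x y} \<Longrightarrow> t\<in>{0..d x y} \<Longrightarrow> d (g s) (g t) = \<bar>s - t\<bar>"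
      unfolding geodesic_segment_def by blast
    define p where "p = g (l * d x y)"
    have lD: "l * d x y \<in> {0..d x y}" using l by (auto simp: mult_left_le_one_le)
    have p: "p \<in> M" "p \<in> S" "d x p = l * d x y"
      using g(1,3) lD g(4)[of 0 "l * d x y"] l by (auto simp: p_def g(2))
    show "\<exists>p\<in>M. \<forall>z\<in>M. (d z p)\<^sup>2 \<le> (1 - l) * (d z x)\<^sup>2 + l * (d z y)\<^sup>2 - l * (1 - l) * (d x y)\<^sup>2"
    proof (intro bexI[OF _ p(1)] ballI)
      fix z assume z: "z \<in> M"
      obtain T where T: "geodesic_segment M d x z T"
        using geod xy z by blast
      \<comment> \<open>The comparison is applied with \<open>q = z\<close>, the far end of
        \<open>T\<close>, and \<open>q' = z'\<close>.\<close>
      then have "z \<in> T" unfolding geodesic_segment_def by (auto intro!: image_eqI[of z _ "d x z"])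
      obtain x' y' z' :: "real^2" where e: "dist x' y' = d x y" "dist y' z' = d y z" "dist x' z' = d x z"
      proof (rule comparison_triangle[of "d x y" "d x z" "d y z"])
        show "d x y \<le> d x z + d y z" "d x z \<le> d x y + d y z" "d y z \<le> d x y + d x z"
          using triangle' triangle triangle'' xy z by blast+
      qed auto
      define p' where "p' = x' + l *\<^sub>R (y' - x')"
      have "p' \<in> closed_segment x' y'"
        using l by (auto simp: p'_def closed_segment_def algebra_simps intro!: exI[of _ l])
      moreover have "dist x' p' = d x p"
        using l by (simp add: p p'_def dist_norm flip: e) (metis dist_commute dist_norm)
      ultimately have "d p z \<le> dist p' z'"
        using cat_ineq[OF xy z S T p(2) \<open>z \<in> T\<close> e] e(3) by simp
      then have "(d z p)\<^sup>2 \<le> (dist p' z')\<^sup>2" by (simp add: commute power_mono)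
      also have "\<dots> = (1 - l) * (d z x)\<^sup>2 + l * (d z y)\<^sup>2 - l * (1 - l) * (d x y)\<^sup>2"
        using euclidean_stewart[of x' l y' z'] e by (simp add: p'_def commute dist_commute)
      finally show "(d z p)\<^sup>2 \<le> \<dots>" .
    qed
  qed
qed

section \<open>Points dividing a geodesic, and convexity of the distance\<close>

context hadamard
begin

text \<open>This is the point of the geodesic from \<open>x\<close> to \<open>y\<close> at the
  fraction \<open>l\<close>. Its two distances to the ends determine it, so no parametrised geodesic
  has to be carried along.\<close>

definition between :: "'a \<Rightarrow> 'a \<Rightarrow> real \<Rightarrow> 'a \<Rightarrow> bool" where
  "between x y l p \<longleftrightarrow> p \<in> M \<and> d x p = l * d x y \<and> d p y = (1 - l) * d x y"

text \<open>Stewart's inequality at \<open>z = x\<close> and \<open>z = y\<close> bounds the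
  distances from \<open>p\<close> to the two ends from above; the triangle inequality then forces
  equality in both.\<close>

lemma between_exists:
  assumes "x \<in> M" "y \<in> M" "0 \<le> l" "l \<le> 1"
  obtains p where "between x y l p"
    "\<And>z. z \<in> M \<Longrightarrow> (d z p)\<^sup>2 \<le> (1 - l) * (d z x)\<^sup>2 + l * (d z y)\<^sup>2 - l * (1 - l) * (d x y)\<^sup>2"
proof -
  obtain p where p: "p \<in> M" "\<And>z. z \<in> M \<Longrightarrow>
      (d z p)\<^sup>2 \<le> (1 - l) * (d z x)\<^sup>2 + l * (d z y)\<^sup>2 - l * (1 - l) * (d x y)\<^sup>2"
    using stewart_point[OF assms] by blast
  have eq: "l * (d x y)\<^sup>2 - l * (1 - l) * (d x y)\<^sup>2 = (l * d x y)\<^sup>2"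
    "(1 - l) * (d x y)\<^sup>2 - l * (1 - l) * (d x y)\<^sup>2 = ((1 - l) * d x y)\<^sup>2" by algebra+
  have "(d x p)\<^sup>2 \<le> (l * d x y)\<^sup>2" "(d p y)\<^sup>2 \<le> ((1 - l) * d x y)\<^sup>2"
    unfolding eq[symmetric]
    using p(2)[OF assms(1)] p(2)[OF assms(2)] assms(1,2) commute[of y x] commute[of y p] by auto
  then have "d x p \<le> l * d x y" "d p y \<le> (1 - l) * d x y"
    using assms by (auto elim!: power2_le_imp_le)
  moreover have "d x y \<le> d x p + d p y" using triangle p assms by blast
  ultimately have "between x y l p"
    using p by (simp add: between_def algebra_simps)
  then show ?thesis using that p by blast
qed

lemma between_ex: "x \<in> M \<Longrightarrow> y \<in> M \<Longrightarrow> 0 \<le> l \<Longrightarrow> l \<le> 1 \<Longrightarrow> \<exists>p. between x y l p"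
  by (metis between_exists)

text \<open>At a point with the prescribed distances to \<open>x\<close> and \<open>y\<close> the
  right-hand side of Stewart's inequality vanishes, so every such point coincides with
  \<open>r\<close>.\<close>

lemma between_unique:
  assumes "x \<in> M" "y \<in> M" "0 \<le> l" "l \<le> 1" "between x y l p" "between x y l q"
  shows "p = q"
proof -
  obtain r where r: "between x y l r" "\<And>z. z \<in> M \<Longrightarrow>
      (d z r)\<^sup>2 \<le> (1 - l) * (d z x)\<^sup>2 + l * (d z y)\<^sup>2 - l * (1 - l) * (d x y)\<^sup>2"
    using between_exists[OF assms(1-4)] by blast
  have "z = r" if "between x y l z" for z
  proof -
    have z: "z \<in> M" "d z x = l * d x y" "d z y = (1 - l) * d x y"
      using that by (auto simp: between_def commute)
    have "(d z r)\<^sup>2 \<le> 0"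
      using r(2)[OF z(1)] unfolding z by (simp add: power2_eq_square algebra_simps)
    then show ?thesis using r(1) z(1) zero by (auto simp: between_def)
  qed
  then show ?thesis using assms by blast
qed

lemma stewart:
  assumes "x \<in> M" "y \<in> M" "0 \<le> l" "l \<le> 1" "between x y l p" "z \<in> M"
  shows "(d z p)\<^sup>2 \<le> (1 - l) * (d z x)\<^sup>2 + l * (d z y)\<^sup>2 - l * (1 - l) * (d x y)\<^sup>2"
  using between_exists[OF assms(1-4)] between_unique[OF assms(1-5)] assms(6) by metis

text \<open>Stewart's inequality is used twice: for \<open>q\<close> dividing \<open>x z\<close>,
  seen from \<open>p\<close>, and for \<open>p\<close> dividing \<open>x y\<close>, seen from
  \<open>z\<close>. By the law of cosines the bound is the squared distance of the corresponding
  points of the Euclidean comparison triangle.\<close>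

lemma two_sides:
  assumes "x \<in> M" "y \<in> M" "z \<in> M" "0 \<le> l" "l \<le> 1" "0 \<le> m" "m \<le> 1"
    and p: "between x y l p" and q: "between x z m q"
  shows "(d p q)\<^sup>2 \<le> l\<^sup>2 * (d x y)\<^sup>2 + m\<^sup>2 * (d x z)\<^sup>2
    - l * m * ((d x y)\<^sup>2 + (d x z)\<^sup>2 - (d y z)\<^sup>2)"
proof -
  have pM: "p \<in> M" "d p x = l * d x y" using p by (auto simp: between_def commute)
  have "(d p q)\<^sup>2 \<le> (1 - m) * (d p x)\<^sup>2 + m * (d p z)\<^sup>2 - m * (1 - m) * (d x z)\<^sup>2"
    by (rule stewart) (use assms pM in auto)
  also have "\<dots> \<le> (1 - m) * (l * d x y)\<^sup>2
      + m * ((1 - l) * (d x z)\<^sup>2 + l * (d y z)\<^sup>2 - l * (1 - l) * (d x y)\<^sup>2) - m * (1 - m) * (d x z)\<^sup>2"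
    using stewart[OF assms(1,2,4,5) p assms(3)] assms
    by (intro add_mono diff_mono mult_left_mono) (auto simp: commute pM)
  finally show ?thesis by (simp add: power2_eq_square algebra_simps)
qed

text \<open>For equal fractions the bound of \<open>two_sides\<close> collapses to
  \<open>(l * d y z)\<^sup>2\<close>.\<close>

lemma thales:
  assumes "x \<in> M" "y \<in> M" "z \<in> M" "0 \<le> l" "l \<le> 1" "between x y l p" "between x z l q"
  shows "d p q \<le> l * d y z"
proof -
  have "(d p q)\<^sup>2 \<le> (l * d y z)\<^sup>2"
    using two_sides[OF assms(1-5,4-7)] by (simp add: power2_eq_square algebra_simps)
  then show ?thesis using assms by (auto elim!: power2_le_imp_le)
qed

lemma between_sym: "between x y l p \<Longrightarrow> between y x (1 - l) p"
  by (auto simp: between_def commute)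

text \<open>The quadrilateral is cut along the diagonal from \<open>x\<close> to \<open>y'\<close>.
  The point \<open>q\<close> at the fraction \<open>l\<close> of this diagonal links the two
  triangles, and \<open>thales\<close> applies to each.\<close>

lemma distance_convex:
  assumes "x \<in> M" "y \<in> M" "x' \<in> M" "y' \<in> M" "0 \<le> l" "l \<le> 1"
    and "between x y l p" "between x' y' l p'"
  shows "d p p' \<le> (1 - l) * d x x' + l * d y y'"
proof -
  obtain q where q: "between x y' l q" using between_exists assms by meson
  have "d p q \<le> l * d y y'" using thales assms q by blast
  moreover have "d q p' \<le> (1 - l) * d x x'"
    using thales[of y' x x' "1 - l" q p'] assms q between_sym by auto
  moreover have "d p p' \<le> d p q + d q p'"
    using assms q triangle by (auto simp: between_def)
  ultimately show ?thesis by linarith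
qed

text \<open>With \<open>m\<close> the midpoint of the diagonal \<open>x z\<close>, Stewart's
  inequality seen from \<open>y\<close> and from \<open>w\<close> bounds \<open>d y m\<close> and
  \<open>d w m\<close>; together they bound the other diagonal, since
  \<open>(s + t)\<^sup>2 \<le> 2 * s\<^sup>2 + 2 * t\<^sup>2\<close>.\<close>

lemma quadrilateral:
  assumes "x \<in> M" "y \<in> M" "z \<in> M" "w \<in> M"
  shows "(d x z)\<^sup>2 + (d y w)\<^sup>2 \<le> (d x y)\<^sup>2 + (d y z)\<^sup>2 + (d z w)\<^sup>2 + (d w x)\<^sup>2"
proof -
  obtain m where m: "between x z (1/2) m" using between_exists[of x z "1/2"] assms by auto
  then have mM: "m \<in> M" by (simp add: between_def)
  have "(d y m)\<^sup>2 \<le> 1/2 * (d x y)\<^sup>2 + 1/2 * (d y z)\<^sup>2 - 1/4 * (d x z)\<^sup>2"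
    "(d w m)\<^sup>2 \<le> 1/2 * (d w x)\<^sup>2 + 1/2 * (d z w)\<^sup>2 - 1/4 * (d x z)\<^sup>2"
    using stewart[OF assms(1,3) _ _ m assms(2)] stewart[OF assms(1,3) _ _ m assms(4)]
    by (simp_all add: commute)
  moreover have "(d y w)\<^sup>2 \<le> (d y m + d w m)\<^sup>2"
    using triangle'[of y m w] assms mM by (simp add: power_mono)
  moreover have "(d y m + d w m)\<^sup>2 \<le> 2 * (d y m)\<^sup>2 + 2 * (d w m)\<^sup>2"
    using sum_squares_bound[of "d y m" "d w m"] by (simp add: power2_sum)
  ultimately show ?thesis by linarith
qed

lemma converges:
  assumes "range s \<subseteq> M" "\<And>e. e > 0 \<Longrightarrow> \<exists>N. \<forall>m\<ge>N. \<forall>n\<ge>N. d (s m) (s n) < e"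
  obtains l where "l \<in> M" "(\<lambda>n. d (s n) l) \<longlonglongrightarrow> 0"
proof -
  have "MCauchy s" unfolding MCauchy_def using assms by meson
  then obtain l where "limitin mtopology s l sequentially"
    using complete unfolding mcomplete_def by blast
  then show ?thesis
    using that by (auto simp: limitin_metric_dist_null)
qed

lemma dist_tendsto:
  assumes "x \<in> M" "y \<in> M" "\<And>n. u n \<in> M" "\<And>n. v n \<in> M"
    and "((\<lambda>n. d (u n) x) \<longlongrightarrow> 0) F" "((\<lambda>n. d (v n) y) \<longlongrightarrow> 0) F"
  shows "((\<lambda>n. d (u n) (v n)) \<longlongrightarrow> d x y) F"
proof (rule LIM_zero_cancel, rule Lim_null_comparison)
  have "\<bar>d (u n) (v n) - d x y\<bar> \<le> d (u n) x + d (v n) y" for n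
    using assms(1-4) triangle[of "u n" x "v n"] triangle[of x y "v n"] triangle[of x "u n" y]
      triangle[of "u n" "v n" y] commute by smt
  then show "\<forall>\<^sub>F n in F. norm (d (u n) (v n) - d x y) \<le> d (u n) x + d (v n) y"
    by simp
  show "((\<lambda>n. d (u n) x + d (v n) y) \<longlongrightarrow> 0) F"
    using tendsto_add[OF assms(5,6)] by simp
qed

end

section \<open>Asymptotic rays\<close>

text \<open>The cosine is kept apart from \<open>arccos\<close>, so that estimates remain
  inequalities between rational expressions in distances and the angle itself enters only in the
  limit.\<close>

definition comparison_cos :: "('a \<Rightarrow> 'a \<Rightarrow> real) \<Rightarrow> 'a \<Rightarrow> 'a \<Rightarrow> 'a \<Rightarrow> real" where
  "comparison_cos d b x y = ((d b x)\<^sup>2 + (d b y)\<^sup>2 - (d x y)\<^sup>2) / (2 * d b x * d b y)"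

lemma comparison_angle_eq_arccos: "comparison_angle d b x y = arccos (comparison_cos d b x y)"
  by (simp add: comparison_angle_def comparison_cos_def)

lemma rays_mem: "r \<in> rays M d \<Longrightarrow> 0 \<le> t \<Longrightarrow> r t \<in> M"
  by (auto simp: rays_def)

lemma rays_dist: "r \<in> rays M d \<Longrightarrow> 0 \<le> s \<Longrightarrow> 0 \<le> t \<Longrightarrow> d (r s) (r t) = \<bar>s - t\<bar>"
  by (auto simp: rays_def)

lemma rays_eqI:
  assumes "r \<in> rays M d" "r' \<in> rays M d" "\<And>t. 0 \<le> t \<Longrightarrow> r t = r' t"
  shows "r = r'"
proof -
  have "r \<in> extensional {0..}" "r' \<in> extensional {0..}"
    using assms(1,2) by (auto simp: rays_def PiE_def)
  then show ?thesis using assms(3) by (intro extensionalityI) auto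
qed

lemma asymptotic_raysD:
  assumes "(r, r') \<in> asymptotic M d"
  shows "r \<in> rays M d" "r' \<in> rays M d"
  using assms by (auto simp: asymptotic_def)

lemma (in Metric_space) equiv_asymptotic: "equiv (rays M d) (asymptotic M d)"
proof (rule equivI)
  show "asymptotic M d \<subseteq> rays M d \<times> rays M d" by (auto simp: asymptotic_def)
  show "refl_on (rays M d) (asymptotic M d)"
    by (auto simp: refl_on_def asymptotic_def rays_mem intro!: exI[of _ 0])
  show "sym (asymptotic M d)"
    by (auto simp: sym_def asymptotic_def commute)
  show "trans (asymptotic M d)"
  proof (rule transI)
    fix r s u assume rs: "(r, s) \<in> asymptotic M d" and su: "(s, u) \<in> asymptotic M d"
    obtain C where C: "\<And>t. t \<ge> 0 \<Longrightarrow> d (r t) (s t) \<le> C" using rs by (auto simp: asymptotic_def)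
    obtain C' where C': "\<And>t. t \<ge> 0 \<Longrightarrow> d (s t) (u t) \<le> C'" using su by (auto simp: asymptotic_def)
    have mem: "r \<in> rays M d" "s \<in> rays M d" "u \<in> rays M d"
      using rs su by (auto simp: asymptotic_def)
    have "d (r t) (u t) \<le> C + C'" if "t \<ge> 0" for t
      using triangle[of "r t" "s t" "u t"] rays_mem[OF _ that] mem C[OF that] C'[OF that] by force
    then show "(r, u) \<in> asymptotic M d"
      using mem by (auto simp: asymptotic_def)
  qed
qed

context hadamard
begin

text \<open>The upper bound is \<open>two_sides\<close> for the degenerate triangle
  \<open>x y y\<close>; the lower bound is the triangle inequality at \<open>x\<close>.\<close>

lemma between_dist:
  assumes "x \<in> M" "y \<in> M" "0 \<le> l" "l \<le> 1" "0 \<le> m" "m \<le> 1"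
    and p: "between x y l p" and q: "between x y m q"
  shows "d p q = \<bar>l - m\<bar> * d x y"
proof (rule antisym)
  have "(d p q)\<^sup>2 \<le> (\<bar>l - m\<bar> * d x y)\<^sup>2"
    using two_sides[OF assms(1,2,2-8)] assms(2)
    by (simp add: power_mult_distrib) (simp add: power2_eq_square algebra_simps)
  then show "d p q \<le> \<bar>l - m\<bar> * d x y" by (auto elim!: power2_le_imp_le)
  have pq: "p \<in> M" "q \<in> M" using p q by (auto simp: between_def)
  have "\<bar>d x p - d x q\<bar> \<le> d p q"
    using triangle[of x p q] triangle'[of x q p] pq assms(1) by (simp add: abs_le_iff)
  then have "\<bar>l * d x y - m * d x y\<bar> \<le> d p q" using p q by (simp add: between_def)
  then show "\<bar>l - m\<bar> * d x y \<le> d p q"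
    by (simp add: abs_mult flip: left_diff_distrib)
qed

text \<open>Shrinking the sides of the Euclidean triangle keeps its angle, while by
  \<open>two_sides\<close> the actual distance \<open>d p q\<close> is at most the Euclidean one.
  Hence the comparison angle at \<open>x\<close> cannot grow.\<close>

lemma comparison_cos_antimono:
  assumes "x \<in> M" "y \<in> M" "z \<in> M" "x \<noteq> y" "x \<noteq> z" "0 < l" "l \<le> 1" "0 < m" "m \<le> 1"
    and p: "between x y l p" and q: "between x z m q"
  shows "comparison_cos d x y z \<le> comparison_cos d x p q"
proof -
  have pos: "0 < d x y" "0 < d x z" using assms by auto
  have eq: "d x p = l * d x y" "d x q = m * d x z" using p q by (auto simp: between_def)
  have "comparison_cos d x y z
      = l * m * ((d x y)\<^sup>2 + (d x z)\<^sup>2 - (d y z)\<^sup>2) / (2 * (l * d x y) * (m * d x z))"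
    using assms by (simp add: comparison_cos_def)
  also have "\<dots> \<le> ((l * d x y)\<^sup>2 + (m * d x z)\<^sup>2 - (d p q)\<^sup>2) / (2 * (l * d x y) * (m * d x z))"
    using two_sides[OF assms(1-3) _ _ _ _ p q] assms pos
    by (intro divide_right_mono) (auto simp: power_mult_distrib)
  finally show ?thesis by (simp add: comparison_cos_def eq)
qed

lemma comparison_cos_bounds:
  assumes "x \<in> M" "y \<in> M" "z \<in> M" "x \<noteq> y" "x \<noteq> z"
  shows "comparison_cos d x y z \<in> {-1..1}"
proof -
  have pos: "0 < d x y" "0 < d x z" using assms by auto
  have "\<bar>d x y - d x z\<bar> \<le> \<bar>d y z\<bar>" "\<bar>d y z\<bar> \<le> \<bar>d x y + d x z\<bar>"
    using triangle[of x y z] triangle'[of x z y] triangle''[of y x z] assms by auto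
  then have "(d x y - d x z)\<^sup>2 \<le> (d y z)\<^sup>2" "(d y z)\<^sup>2 \<le> (d x y + d x z)\<^sup>2"
    by (simp_all only: abs_le_square_iff)
  then show ?thesis
    using pos by (simp add: comparison_cos_def divide_simps power2_sum power2_diff)
qed

lemma ray_between:
  assumes "r \<in> rays M d" "0 \<le> t" "t \<le> S" "0 < S"
  shows "between (r 0) (r S) (t / S) (r t)"
  using assms rays_mem[of r M d t] rays_dist[of r M d 0 t] rays_dist[of r M d 0 S] rays_dist[of r M d t S]
  by (simp add: between_def left_diff_distrib)

text \<open>Convexity on the interval from \<open>0\<close> to \<open>S\<close> bounds the distance
  at time \<open>t\<close> by the one at time \<open>0\<close> plus \<open>t / S\<close> times a
  bound valid at all times; then \<open>S\<close> tends to infinity.\<close>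

lemma asymptotic_dist_le:
  assumes "(r, r') \<in> asymptotic M d" "0 \<le> t"
  shows "d (r t) (r' t) \<le> d (r 0) (r' 0)"
proof -
  obtain C where C: "\<And>t. t \<ge> 0 \<Longrightarrow> d (r t) (r' t) \<le> C" and r: "r \<in> rays M d" "r' \<in> rays M d"
    using assms(1) by (auto simp: asymptotic_def)
  have "((\<lambda>S. d (r 0) (r' 0) + t * C / S) \<longlongrightarrow> d (r 0) (r' 0) + 0) at_top"
    by (intro tendsto_add tendsto_const tendsto_divide_0[OF tendsto_const]
        filterlim_at_top_imp_at_infinity filterlim_ident)
  then have "((\<lambda>S. d (r 0) (r' 0) + t * C / S) \<longlongrightarrow> d (r 0) (r' 0)) at_top" by simp
  moreover have "\<forall>\<^sub>F S in at_top. d (r t) (r' t) \<le> d (r 0) (r' 0) + t * C / S"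
    using eventually_ge_at_top[of "t + 1"]
  proof eventually_elim
    case (elim S)
    have S: "0 < S" "t \<le> S" using elim assms(2) by auto
    have "d (r t) (r' t) \<le> (1 - t / S) * d (r 0) (r' 0) + t / S * d (r S) (r' S)"
      using S assms(2) r rays_mem by (intro distance_convex ray_between) auto
    also have "\<dots> \<le> 1 * d (r 0) (r' 0) + t / S * C"
      using S assms(2) C[of S] by (intro add_mono mult_right_mono mult_left_mono) auto
    finally show ?case by simp
  qed
  ultimately show ?thesis by (rule tendsto_lowerbound) simp
qed

lemma asymptotic_unique:
  assumes "(r, r') \<in> asymptotic M d" "r 0 = r' 0"
  shows "r = r'"
proof (rule rays_eqI)
  show r: "r \<in> rays M d" "r' \<in> rays M d" using assms asymptotic_raysD by auto
  fix t :: real assume t: "0 \<le> t"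
  have "d (r t) (r' t) \<le> 0"
    using asymptotic_dist_le[OF assms(1) t] assms(2) r rays_mem[of r' M d 0] by simp
  then show "r t = r' t" using zero rays_mem r t by (metis nonneg order_antisym)
qed

text \<open>The fractions in \<open>two_sides\<close> are chosen to put \<open>p\<close> and
  \<open>q\<close> both at distance \<open>t\<close> from \<open>x\<close>. The difference of
  squares vanishes when \<open>y\<close> and \<open>z\<close> lie on one geodesic issuing from
  \<open>x\<close>.\<close>

lemma asymptotic_ray_approx:
  assumes "x \<in> M" "y \<in> M" "z \<in> M" "0 \<le> t" "t \<le> d x y" "t \<le> d x z" "0 < d x y" "0 < d x z"
    and "between x y (t / d x y) p" "between x z (t / d x z) q"
  shows "(d p q)\<^sup>2 \<le> t\<^sup>2 * ((d y z)\<^sup>2 - (d x z - d x y)\<^sup>2) / (d x y * d x z)"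
proof -
  have "(d p q)\<^sup>2 \<le> (t / d x y)\<^sup>2 * (d x y)\<^sup>2 + (t / d x z)\<^sup>2 * (d x z)\<^sup>2
    - (t / d x y) * (t / d x z) * ((d x y)\<^sup>2 + (d x z)\<^sup>2 - (d y z)\<^sup>2)"
    using assms by (intro two_sides) auto
  also have "\<dots> = t\<^sup>2 * ((d y z)\<^sup>2 - (d x z - d x y)\<^sup>2) / (d x y * d x z)"
    using assms(7,8) by (simp add: field_simps power2_eq_square)
  finally show ?thesis .
qed

text \<open>The segments from \<open>x\<close> to \<open>r n\<close> converge: by
  \<open>asymptotic_ray_approx\<close> their points at a fixed distance \<open>t\<close> from
  \<open>x\<close> form a Cauchy sequence, and the limits make up the ray.\<close>

lemma asymptotic_ray_exists:
  assumes r: "r \<in> rays M d" and x: "x \<in> M"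
  obtains r' where "(r, r') \<in> asymptotic M d" "r' 0 = x"
proof -
  define D where "D = d x (r 0)"
  define A where "A n = d x (r (real n))" for n
  have rM: "r t \<in> M" if "0 \<le> t" for t using r rays_mem that by auto
  have D0: "0 \<le> D" by (simp add: D_def)
  have A: "\<bar>A n - real n\<bar> \<le> D" for n
    using triangle[of x "r 0" "r (real n)"] triangle''[of "r 0" x "r (real n)"] rM[of 0] rM[of "real n"] x
      rays_dist[OF r, of 0 "real n"] by (simp add: A_def D_def abs_le_iff)
  define ok where "ok n t \<longleftrightarrow> 0 \<le> t \<and> t \<le> A n \<and> 0 < A n" for n t
  \<comment> \<open>This is the point at distance \<open>t\<close> from \<open>x\<close> on the
    segment to \<open>r n\<close>, as long as the segment reaches that far; the default
    \<open>x\<close> keeps all values in \<open>M\<close>.\<close>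
  define s where "s n t = (if ok n t then SOME p. between x (r (real n)) (t / A n) p else x)" for n t
  have s: "between x (r (real n)) (t / A n) (s n t)" if "ok n t" for n t
  proof -
    have "\<exists>p. between x (r (real n)) (t / A n) p"
      using x rM that by (intro between_ex) (auto simp: ok_def)
    then show ?thesis using that by (auto simp: s_def intro: someI)
  qed
  have sM: "s n t \<in> M" for n t
    using s[of n t] x by (cases "ok n t") (auto simp: between_def s_def)
  have ok: "ok n t" "real n / 2 \<le> A n" if "0 \<le> t" "real n \<ge> 2 * D + 2 * t + 1" for n t
    using A[of n] that D0 by (auto simp: ok_def abs_le_iff)
  \<comment> \<open>The numerator in \<open>asymptotic_ray_approx\<close> is at most
    \<open>4 * D * m\<close>, and \<open>A n\<close> and \<open>A m\<close> are at least half of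
    \<open>n\<close> and \<open>m\<close>; this accounts for the factor 16.\<close>
  have cauchy: "(d (s m t) (s n t))\<^sup>2 \<le> 16 * t\<^sup>2 * D / n"
    if "0 \<le> t" "real n \<ge> 2 * D + 2 * t + 1" "n \<le> m" for m n t
  proof -
    have n0: "0 < real n" using that D0 by linarith
    have m: "real m \<ge> 2 * D + 2 * t + 1" using that by linarith
    note ok' = ok[OF that(1,2)] ok[OF that(1) m]
    have dnm: "d (r (real n)) (r (real m)) = real m - real n"
      using rays_dist[OF r, of n m] that by simp
    have "A m - A n \<le> real m - real n"
      using triangle[of x "r (real n)" "r (real m)"] x rM dnm by (simp add: A_def)
    moreover have "A m - A n \<ge> real m - real n - 2 * D"
      using A[of n] A[of m] by linarith
    moreover have "- (real m - real n) \<le> A m - A n"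
      using triangle[of x "r (real m)" "r (real n)"] x rM dnm commute[of "r (real m)" "r (real n)"]
      by (simp add: A_def)
    \<comment> \<open>A difference of squares: the first factor lies between \<open>0\<close> and
      \<open>2 * D\<close>, the second between \<open>0\<close> and \<open>2 * m\<close>.\<close>
    ultimately have "((real m - real n) - (A m - A n)) * ((real m - real n) + (A m - A n))
        \<le> (2 * D) * (2 * real m)"
      using D0 by (intro mult_mono) auto
    then have num: "(real m - real n)\<^sup>2 - (A m - A n)\<^sup>2 \<le> 4 * D * real m"
      by (simp add: power2_eq_square algebra_simps)
    have "(d (s n t) (s m t))\<^sup>2
        \<le> t\<^sup>2 * ((d (r n) (r m))\<^sup>2 - (d x (r m) - d x (r n))\<^sup>2) / (d x (r n) * d x (r m))"
      using ok' s[of n t] s[of m t] x rM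
      by (intro asymptotic_ray_approx) (auto simp: ok_def A_def)
    also have "\<dots> = t\<^sup>2 * ((real m - real n)\<^sup>2 - (A m - A n)\<^sup>2) / (A n * A m)"
      by (simp add: dnm A_def)
    also have "\<dots> \<le> t\<^sup>2 * (4 * D * real m) / (A n * A m)"
      using num ok' by (intro divide_right_mono mult_left_mono) (auto simp: ok_def)
    also have "\<dots> \<le> t\<^sup>2 * (4 * D * real m) / (real n / 2 * (real m / 2))"
      using ok' n0 that D0 by (intro divide_left_mono mult_mono mult_pos_pos) (auto simp: ok_def)
    also have "\<dots> = 16 * t\<^sup>2 * D / n"
      using n0 that(3) by (simp add: field_simps)
    finally show ?thesis by (simp add: commute)
  qed
  have "\<exists>l\<in>M. (\<lambda>n. d (s n t) l) \<longlonglongrightarrow> 0" if t: "0 \<le> t" for t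
  proof (rule converges[of "\<lambda>n. s n t"])
    show "range (\<lambda>n. s n t) \<subseteq> M" using sM by auto
    fix e :: real assume e: "e > 0"
    obtain N :: nat where N: "real N > max (2 * D + 2 * t + 1) (16 * t\<^sup>2 * D / e\<^sup>2)"
      using reals_Archimedean2 by blast
    have lt: "d (s m t) (s n t) < e" if "N \<le> n" "n \<le> m" for m n
    proof -
      have n: "real n \<ge> real N" using that by simp
      then have "0 < real n" using N D0 t by linarith
      moreover have "16 * t\<^sup>2 * D / e\<^sup>2 < real n" using N n by linarith
      ultimately have "16 * t\<^sup>2 * D / real n < e\<^sup>2" using e by (simp add: field_simps)
      moreover have "(d (s m t) (s n t))\<^sup>2 \<le> 16 * t\<^sup>2 * D / n"
        using cauchy t that n N by auto
      ultimately show ?thesis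
        using e by (meson le_less_trans less_imp_le power_less_imp_less_base)
    qed
    have "d (s m t) (s n t) < e" if "N \<le> n" "N \<le> m" for m n
      using lt[of n m] lt[of m n] that commute[of "s m t" "s n t"] by (cases "n \<le> m") auto
    then show "\<exists>N. \<forall>m\<ge>N. \<forall>n\<ge>N. d (s m t) (s n t) < e" by blast
  qed blast
  then obtain g where g: "\<And>t. 0 \<le> t \<Longrightarrow> g t \<in> M" "\<And>t. 0 \<le> t \<Longrightarrow> (\<lambda>n. d (s n t) (g t)) \<longlonglongrightarrow> 0"
    by metis
  have ev_large: "\<forall>\<^sub>F n in sequentially. real n \<ge> K" for K
    by (metis eventually_sequentiallyI nat_ceiling_le_eq)
  have dg: "d (g t) (g u) = \<bar>t - u\<bar>" if tu: "0 \<le> t" "0 \<le> u" for t u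
  proof (rule tendsto_unique[OF _ dist_tendsto])
    have "\<forall>\<^sub>F n in sequentially. d (s n t) (s n u) = \<bar>t - u\<bar>"
      using ev_large[of "2 * D + 2 * t + 1"] ev_large[of "2 * D + 2 * u + 1"]
    proof eventually_elim
      case (elim n)
      have okn: "ok n t" "ok n u" using ok elim tu by auto
      have "d (s n t) (s n u) = \<bar>t / A n - u / A n\<bar> * d x (r (real n))"
        using okn s[of n t] s[of n u] x rM by (intro between_dist) (auto simp: ok_def)
      then show ?case
        using okn by (simp add: A_def[symmetric] ok_def abs_mult flip: diff_divide_distrib)
    qed
    then show "(\<lambda>n. d (s n t) (s n u)) \<longlonglongrightarrow> \<bar>t - u\<bar>" by (rule tendsto_eventually)
  qed (use g sM tu in auto)
  \<comment> \<open>The link is the point \<open>q\<close> at the fraction \<open>t / n\<close> of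
    the segment from \<open>x\<close> to \<open>r n\<close>. Convexity puts it within
    \<open>D\<close> of \<open>r t\<close>, and it is within \<open>D\<close> of
    \<open>s n t\<close> because \<open>A n\<close> and \<open>n\<close> differ by at most
    \<open>D\<close>.\<close>
  have gr: "d (r t) (g t) \<le> 2 * D" if t: "0 \<le> t" for t
  proof (rule tendsto_lowerbound)
    show "(\<lambda>n. d (s n t) (g t) + 2 * D) \<longlonglongrightarrow> 2 * D"
      using g(2)[OF t] by (auto intro!: tendsto_eq_intros)
    show "\<forall>\<^sub>F n in sequentially. d (r t) (g t) \<le> d (s n t) (g t) + 2 * D"
      using ev_large[of "2 * D + 2 * t + 1"]
    proof eventually_elim
      case (elim n)
      have okn: "ok n t" using ok elim t by auto
      have n: "0 < real n" "t \<le> real n" using elim t D0 by auto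
      have "\<exists>q. between x (r (real n)) (t / n) q"
        using x rM n t by (intro between_ex) auto
      then obtain q where q: "between x (r (real n)) (t / n) q" ..
      have "d q (r t) \<le> (1 - t / n) * d x (r 0) + t / n * d (r n) (r n)"
        using q n t rM x r by (intro distance_convex ray_between) auto
      also have "\<dots> \<le> D"
        using n t rM by (simp add: D_def mult_left_le_one_le)
      finally have 1: "d q (r t) \<le> D" .
      have "d (s n t) q = \<bar>t / A n - t / n\<bar> * d x (r (real n))"
        using okn s[of n t] q x rM n t by (intro between_dist) (auto simp: ok_def)
      also have "\<dots> = \<bar>(t / A n - t / n) * A n\<bar>"
        by (simp add: A_def abs_mult)
      also have "(t / A n - t / n) * A n = (t / n) * (n - A n)"
        using okn n by (simp add: ok_def field_simps)
      also have "\<bar>(t / n) * (n - A n)\<bar> \<le> 1 * D"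
        unfolding abs_mult using A[of n] n t by (intro mult_mono) (auto simp: abs_minus_commute)
      finally have 2: "d (s n t) q \<le> D" by simp
      have qM: "q \<in> M" using q by (simp add: between_def)
      have "d (r t) (g t) \<le> d (r t) q + d q (s n t) + d (s n t) (g t)"
        using triangle[of "r t" q "g t"] triangle[of q "s n t" "g t"] qM sM g(1)[OF t] rM[OF t] by force
      then show ?case using 1 2 by (simp add: commute)
    qed
  qed simp
  have "g 0 = x"
  proof -
    have "\<forall>\<^sub>F n in sequentially. d (s n 0) (g 0) = d x (g 0)"
      using ev_large[of "2 * D + 1"]
    proof eventually_elim
      case (elim n)
      then have "d x (s n 0) = 0" using s[of n 0] ok[of 0 n] by (simp add: between_def)
      then show ?case using zero x sM by metis
    qed
    then have "(\<lambda>n. d x (g 0)) \<longlonglongrightarrow> 0"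
      using g(2)[of 0] by (simp add: tendsto_cong)
    then show ?thesis using x g(1)[of 0] by (simp add: tendsto_const_iff)
  qed
  moreover have "restrict g {0..} \<in> rays M d"
    using g dg by (auto simp: rays_def)
  ultimately show ?thesis
    using that[of "restrict g {0..}"] r gr by (auto simp: asymptotic_def)
qed

end

section \<open>Tits angle\<close>

lemma eventually_ge_at_top_prod:
  "\<forall>\<^sub>F x in at_top \<times>\<^sub>F at_top. S \<le> fst x \<and> T \<le> snd x" for S T :: real
  by (intro eventually_prodI eventually_ge_at_top)

context hadamard
begin

lemma boundary_raysD: "\<xi> \<in> boundary M d \<Longrightarrow> r \<in> \<xi> \<Longrightarrow> r \<in> rays M d"
  using in_quotient_imp_subset[OF equiv_asymptotic] by (auto simp: boundary_def)

lemma boundary_asymptotic: "\<xi> \<in> boundary M d \<Longrightarrow> r \<in> \<xi> \<Longrightarrow> r' \<in> \<xi> \<Longrightarrow> (r, r') \<in> asymptotic M d"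
  using in_quotient_imp_in_rel[OF equiv_asymptotic] by (auto simp: boundary_def)

lemma ray_from_eqI:
  assumes "\<xi> \<in> boundary M d" "r \<in> \<xi>" "r 0 = x"
  shows "ray_from x \<xi> = r"
  unfolding ray_from_def
proof (rule the_equality)
  show "r' = r" if "r' \<in> \<xi> \<and> r' 0 = x" for r'
    using that assms asymptotic_unique boundary_asymptotic by metis
qed (use assms in auto)

text \<open>Existence comes from \<open>asymptotic_ray_exists\<close> and uniqueness from
  \<open>asymptotic_unique\<close>, so the definite description in \<open>ray_from\<close>
  denotes.\<close>

lemma ray_from:
  assumes "\<xi> \<in> boundary M d" "x \<in> M"
  shows "ray_from x \<xi> \<in> \<xi>" "ray_from x \<xi> 0 = x" "ray_from x \<xi> \<in> rays M d"
proof -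
  obtain r where r: "r \<in> \<xi>"
    using assms(1) in_quotient_imp_non_empty[OF equiv_asymptotic] by (auto simp: boundary_def)
  obtain r' where r': "(r, r') \<in> asymptotic M d" "r' 0 = x"
    using asymptotic_ray_exists boundary_raysD r assms by metis
  then have "r' \<in> \<xi>"
    using in_quotient_imp_closed[OF equiv_asymptotic _ r] assms by (auto simp: boundary_def)
  then have "ray_from x \<xi> = r'" using ray_from_eqI assms r' by blast
  then show "ray_from x \<xi> \<in> \<xi>" "ray_from x \<xi> 0 = x" "ray_from x \<xi> \<in> rays M d"
    using \<open>r' \<in> \<xi>\<close> r' asymptotic_raysD by auto
qed

lemma ray_from_mem:
  "\<xi> \<in> boundary M d \<Longrightarrow> x \<in> M \<Longrightarrow> 0 \<le> t \<Longrightarrow> ray_from x \<xi> t \<in> M"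
  using ray_from(3) rays_mem by blast

lemma ray_from_dist:
  "\<xi> \<in> boundary M d \<Longrightarrow> x \<in> M \<Longrightarrow> 0 \<le> s \<Longrightarrow> 0 \<le> t \<Longrightarrow> d (ray_from x \<xi> s) (ray_from x \<xi> t) = \<bar>s - t\<bar>"
  using ray_from(3) rays_dist by blast

lemma ray_from_dist_start:
  "\<xi> \<in> boundary M d \<Longrightarrow> x \<in> M \<Longrightarrow> 0 \<le> t \<Longrightarrow> d x (ray_from x \<xi> t) = t"
  using ray_from_dist[of \<xi> x 0 t] ray_from(2) by simp

lemma ray_from_contract:
  assumes "\<xi> \<in> boundary M d" "x \<in> M" "y \<in> M" "0 \<le> t"
  shows "d (ray_from x \<xi> t) (ray_from y \<xi> t) \<le> d x y"
  using asymptotic_dist_le[OF boundary_asymptotic[OF assms(1) ray_from(1) ray_from(1)]]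
    ray_from(2) assms by metis

lemma ray_from_between:
  assumes "\<xi> \<in> boundary M d" "x \<in> M" "0 \<le> t" "t \<le> S" "0 < S"
  shows "between x (ray_from x \<xi> S) (t / S) (ray_from x \<xi> t)"
  using ray_between[OF ray_from(3)] ray_from(2) assms by metis

section \<open>Comparison cosines along two rays from one point\<close>

lemma comparison_cos_rays_eq:
  assumes "\<xi> \<in> boundary M d" "\<eta> \<in> boundary M d" "b \<in> M" "0 < s" "0 < t"
  shows "comparison_cos d b (ray_from b \<xi> s) (ray_from b \<eta> t)
    = (s\<^sup>2 + t\<^sup>2 - (d (ray_from b \<xi> s) (ray_from b \<eta> t))\<^sup>2) / (2 * s * t)"
  using assms ray_from_dist_start by (simp add: comparison_cos_def)

lemma comparison_cos_rays_antimono: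
  assumes "\<xi> \<in> boundary M d" "\<eta> \<in> boundary M d" "b \<in> M" "0 < s" "s \<le> s'" "0 < t" "t \<le> t'"
  shows "comparison_cos d b (ray_from b \<xi> s') (ray_from b \<eta> t')
    \<le> comparison_cos d b (ray_from b \<xi> s) (ray_from b \<eta> t)"
proof (rule comparison_cos_antimono)
  show "between b (ray_from b \<xi> s') (s / s') (ray_from b \<xi> s)"
    "between b (ray_from b \<eta> t') (t / t') (ray_from b \<eta> t)"
    using assms by (auto intro!: ray_from_between)
  have "d b (ray_from b \<xi> s') \<noteq> 0" "d b (ray_from b \<eta> t') \<noteq> 0"
    using assms ray_from_dist_start by auto
  then show "b \<noteq> ray_from b \<xi> s'" "b \<noteq> ray_from b \<eta> t'" using assms(3) by auto
qed (use assms ray_from_mem in auto)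

lemma comparison_cos_rays_bounds:
  assumes "\<xi> \<in> boundary M d" "\<eta> \<in> boundary M d" "b \<in> M" "0 < s" "0 < t"
  shows "comparison_cos d b (ray_from b \<xi> s) (ray_from b \<eta> t) \<in> {-1..1}"
proof (rule comparison_cos_bounds)
  have "d b (ray_from b \<xi> s) \<noteq> 0" "d b (ray_from b \<eta> t) \<noteq> 0"
    using assms ray_from_dist_start by auto
  then show "b \<noteq> ray_from b \<xi> s" "b \<noteq> ray_from b \<eta> t" using assms(3) by auto
qed (use assms ray_from_mem in auto)

text \<open>Rays of one class from \<open>b\<close> and \<open>b'\<close> stay within
  \<open>d b b'\<close> of each other, so \<open>x\<close> and \<open>y\<close> differ by at most
  \<open>2 * d b b'\<close>, while their sum is at most \<open>2 * (s + t)\<close>. The bound tends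
  to \<open>0\<close>, which yields independence of the base point.\<close>

lemma comparison_cos_rays_base:
  assumes "\<xi> \<in> boundary M d" "\<eta> \<in> boundary M d" "b \<in> M" "b' \<in> M" "0 < s" "0 < t"
  shows "\<bar>comparison_cos d b (ray_from b \<xi> s) (ray_from b \<eta> t)
      - comparison_cos d b' (ray_from b' \<xi> s) (ray_from b' \<eta> t)\<bar> \<le> 2 * d b b' * (1 / s + 1 / t)"
proof -
  define x where "x = d (ray_from b \<xi> s) (ray_from b \<eta> t)"
  define y where "y = d (ray_from b' \<xi> s) (ray_from b' \<eta> t)"
  have mem: "ray_from b \<xi> s \<in> M" "ray_from b \<eta> t \<in> M" "ray_from b' \<xi> s \<in> M" "ray_from b' \<eta> t \<in> M"
    using assms ray_from_mem by auto
  have le: "x \<le> s + t" "y \<le> s + t"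
    using triangle[of "ray_from b \<xi> s" b "ray_from b \<eta> t"] triangle[of "ray_from b' \<xi> s" b' "ray_from b' \<eta> t"]
      mem assms ray_from_dist_start[of \<xi> b s] ray_from_dist_start[of \<eta> b t]
      ray_from_dist_start[of \<xi> b' s] ray_from_dist_start[of \<eta> b' t]
    by (auto simp: x_def y_def commute)
  have con: "d (ray_from b \<xi> s) (ray_from b' \<xi> s) \<le> d b b'" "d (ray_from b \<eta> t) (ray_from b' \<eta> t) \<le> d b b'"
    using assms by (auto intro: ray_from_contract)
  have "x \<le> y + 2 * d b b'" "y \<le> x + 2 * d b b'"
    unfolding x_def y_def using con mem commute triangle by smt+
  then have "\<bar>x - y\<bar> \<le> 2 * d b b'" by (simp add: abs_le_iff)
  moreover have "\<bar>x + y\<bar> \<le> 2 * (s + t)" using le by (simp add: x_def y_def)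
  ultimately have "\<bar>x - y\<bar> * \<bar>x + y\<bar> \<le> (2 * d b b') * (2 * (s + t))"
    by (intro mult_mono) auto
  moreover have "\<bar>y\<^sup>2 - x\<^sup>2\<bar> = \<bar>x - y\<bar> * \<bar>x + y\<bar>"
    by (simp add: power2_eq_square square_diff_square_factored abs_mult abs_minus_commute add.commute mult.commute)
  ultimately have *: "\<bar>y\<^sup>2 - x\<^sup>2\<bar> \<le> 4 * d b b' * (s + t)"
    by (simp add: algebra_simps)
  have "comparison_cos d b (ray_from b \<xi> s) (ray_from b \<eta> t)
      - comparison_cos d b' (ray_from b' \<xi> s) (ray_from b' \<eta> t) = (y\<^sup>2 - x\<^sup>2) / (2 * s * t)"
    using assms by (simp add: comparison_cos_rays_eq x_def y_def flip: diff_divide_distrib)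
  also have "\<bar>\<dots>\<bar> \<le> 4 * d b b' * (s + t) / (2 * s * t)"
    using divide_right_mono[OF *, of "2 * s * t"] assms by (simp add: abs_mult)
  also have "\<dots> = 2 * d b b' * (1 / s + 1 / t)"
    using assms by (simp add: field_simps)
  finally show ?thesis .
qed

text \<open>The cosine is antitone in both parameters and bounded below, so its infimum is its
  limit.\<close>

lemma comparison_cos_tendsto:
  assumes "\<xi> \<in> boundary M d" "\<eta> \<in> boundary M d" "b \<in> M"
  defines "L \<equiv> INF x\<in>{0<..} \<times> {0<..}. comparison_cos d b (ray_from b \<xi> (fst x)) (ray_from b \<eta> (snd x))"
  shows "((\<lambda>x. comparison_cos d b (ray_from b \<xi> (fst x)) (ray_from b \<eta> (snd x))) \<longlongrightarrow> L) (at_top \<times>\<^sub>F at_top)"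
    and "L \<in> {-1..1}"
proof -
  let ?f = "\<lambda>x. comparison_cos d b (ray_from b \<xi> (fst x)) (ray_from b \<eta> (snd x))"
  have bnd: "?f x \<in> {-1..1}" if "x \<in> {0<..} \<times> {0<..}" for x
    using comparison_cos_rays_bounds[OF assms(1-3)] that by auto
  have bdd: "bdd_below (?f ` ({0<..} \<times> {0<..}))"
    using bnd by (intro bdd_belowI2[of _ "-1"]) auto
  have le: "L \<le> ?f x" if "x \<in> {0<..} \<times> {0<..}" for x
    unfolding L_def using bdd that by (rule cINF_lower)
  show "(?f \<longlongrightarrow> L) (at_top \<times>\<^sub>F at_top)"
  proof (rule order_tendstoI)
    fix a assume "a < L"
    show "\<forall>\<^sub>F x in at_top \<times>\<^sub>F at_top. a < ?f x"
      using eventually_ge_at_top_prod[of 1 1]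
    proof eventually_elim
      case (elim x)
      then have "x \<in> {0<..} \<times> {0<..}" by (auto simp: mem_Times_iff)
      then show ?case using le \<open>a < L\<close> by (meson less_le_trans)
    qed
  next
    fix a assume "L < a"
    moreover have "{0<..} \<times> {0<..} \<noteq> ({} :: (real \<times> real) set)" by auto
    ultimately obtain y where y: "y \<in> {0<..} \<times> {0<..}" "?f y < a"
      unfolding L_def using bdd by (auto simp: cINF_less_iff)
    show "\<forall>\<^sub>F x in at_top \<times>\<^sub>F at_top. ?f x < a"
      using eventually_ge_at_top_prod[of "fst y" "snd y"]
    proof eventually_elim
      case (elim x)
      then have "?f x \<le> ?f y"
        using y assms by (intro comparison_cos_rays_antimono) auto
      then show ?case using y by linarith
    qed
  qed
  have "-1 \<le> L"
    unfolding L_def using bnd by (intro cINF_greatest) auto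
  then show "L \<in> {-1..1}"
    using le[of "(1, 1)"] bnd[of "(1, 1)"] by auto
qed

text \<open>The cosine of the Tits angle equals the infimum \<open>L\<close> of the comparison
  cosines at any one base point, so it inherits their lower bounds.\<close>

lemma cos_tits_angle_ge:
  assumes \<xi>: "\<xi> \<in> boundary M d" and \<eta>: "\<eta> \<in> boundary M d" and b: "b \<in> M"
    and K: "\<And>s t. 0 < s \<Longrightarrow> 0 < t \<Longrightarrow> K \<le> comparison_cos d b (ray_from b \<xi> s) (ray_from b \<eta> t)"
  shows "K \<le> cos (tits_angle M d \<xi> \<eta>)"
proof -
  define F where "F b x = comparison_cos d b (ray_from b \<xi> (fst x)) (ray_from b \<eta> (snd x))" for b x
  define L where "L = (INF x\<in>{0<..} \<times> {0<..}. F b x)"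
  have lim: "(F b \<longlongrightarrow> L) (at_top \<times>\<^sub>F at_top)" and L: "L \<in> {-1..1}"
    using comparison_cos_tendsto[OF \<xi> \<eta> b] by (simp_all add: F_def[abs_def] L_def)
  have nontriv: "at_top \<times>\<^sub>F at_top \<noteq> (bot :: (real \<times> real) filter)"
    by (simp add: prod_filter_eq_bot)
  have "((\<lambda>x. arccos (F b' x)) \<longlongrightarrow> arccos L) (at_top \<times>\<^sub>F at_top)" if b': "b' \<in> M" for b'
  proof (rule continuous_on_tendsto_compose[OF continuous_on_arccos'])
    \<comment> \<open>The limit found at \<open>b\<close> is transferred to \<open>b'\<close>, since
      the description in \<open>tits_angle\<close> asks for one limit serving all base
      points.\<close>
    have "((\<lambda>x. F b' x - F b x) \<longlongrightarrow> 0) (at_top \<times>\<^sub>F at_top)"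
    proof (rule Lim_null_comparison)
      show "\<forall>\<^sub>F x in at_top \<times>\<^sub>F at_top. norm (F b' x - F b x) \<le> 2 * d b' b * (1 / fst x + 1 / snd x)"
        using eventually_ge_at_top_prod[of 1 1]
      proof eventually_elim
        case (elim x)
        then show ?case
          unfolding F_def real_norm_def using \<xi> \<eta> b b' by (intro comparison_cos_rays_base) auto
      qed
      have "((\<lambda>x. 1 / fst x) \<longlongrightarrow> (0::real)) (at_top \<times>\<^sub>F at_top)"
        "((\<lambda>x. 1 / snd x) \<longlongrightarrow> (0::real)) (at_top \<times>\<^sub>F at_top)"
        by (auto intro!: tendsto_divide_0[OF tendsto_const] filterlim_at_top_imp_at_infinity
            filterlim_fst filterlim_snd)
      then show "((\<lambda>x. 2 * d b' b * (1 / fst x + 1 / snd x)) \<longlongrightarrow> 0) (at_top \<times>\<^sub>F at_top)"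
        using tendsto_mult_right_zero[OF tendsto_add_zero] by blast
    qed
    from tendsto_add[OF this lim] show "(F b' \<longlongrightarrow> L) (at_top \<times>\<^sub>F at_top)" by simp
    show "\<forall>\<^sub>F x in at_top \<times>\<^sub>F at_top. F b' x \<in> {-1..1}"
      using eventually_ge_at_top_prod[of 1 1]
    proof eventually_elim
      case (elim x)
      then show ?case
        unfolding F_def using \<xi> \<eta> b' by (intro comparison_cos_rays_bounds) auto
    qed
  qed (use L in auto)
  then have lims: "((\<lambda>(t, t'). comparison_angle d b (ray_from b \<xi> t) (ray_from b \<eta> t')) \<longlongrightarrow> arccos L)
      (at_top \<times>\<^sub>F at_top)" if "b \<in> M" for b
    using that by (simp add: F_def comparison_angle_eq_arccos case_prod_unfold)
  have "tits_angle M d \<xi> \<eta> = arccos L"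
    unfolding tits_angle_def
    by (rule the_equality) (use lims b tendsto_unique[OF nontriv] in blast)+
  then have "cos (tits_angle M d \<xi> \<eta>) = L" using L by simp
  moreover have "K \<le> L" unfolding L_def F_def using K by (intro cINF_greatest) auto
  ultimately show ?thesis by simp
qed

end

section \<open>Weak contractions\<close>

lemma tendsto_sum_list:
  fixes f :: "'b \<Rightarrow> 'c \<Rightarrow> 'd::topological_monoid_add"
  assumes "\<And>x. x \<in> set xs \<Longrightarrow> (f x \<longlongrightarrow> g x) F"
  shows "((\<lambda>k. \<Sum>x\<leftarrow>xs. f x k) \<longlongrightarrow> (\<Sum>x\<leftarrow>xs. g x)) F"
  using assms by (induction xs) (auto intro!: tendsto_add)

lemma weak_contraction_Nil [simp]: "weak_contraction [] x = x"
  by (simp add: weak_contraction_def)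

lemma weak_contraction_Cons [simp]:
  "weak_contraction (a # c) x = weak_contraction c (push (fst a) (snd a) x)"
  by (simp add: weak_contraction_def case_prod_unfold)

lemma weak_contraction_append [simp]:
  "weak_contraction (c @ c') x = weak_contraction c' (weak_contraction c x)"
  by (simp add: weak_contraction_def)

lemma weighted_config_Cons [simp]:
  "weighted_config M d (a # c) \<longleftrightarrow> fst a \<in> boundary M d \<and> snd a > 0 \<and> weighted_config M d c"
  by (auto simp: weighted_config_def)

context hadamard
begin

lemma push_mem: "\<xi> \<in> boundary M d \<Longrightarrow> x \<in> M \<Longrightarrow> 0 \<le> m \<Longrightarrow> push \<xi> m x \<in> M"
  using ray_from_mem by (simp add: push_def)

lemma dist_push: "\<xi> \<in> boundary M d \<Longrightarrow> x \<in> M \<Longrightarrow> 0 \<le> m \<Longrightarrow> d x (push \<xi> m x) = m"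
  using ray_from_dist_start by (simp add: push_def)

lemma push_contract:
  "\<xi> \<in> boundary M d \<Longrightarrow> x \<in> M \<Longrightarrow> y \<in> M \<Longrightarrow> 0 \<le> m \<Longrightarrow> d (push \<xi> m x) (push \<xi> m y) \<le> d x y"
  using ray_from_contract by (simp add: push_def)

lemma weak_contraction_mem: "weighted_config M d c \<Longrightarrow> x \<in> M \<Longrightarrow> weak_contraction c x \<in> M"
  by (induction c arbitrary: x) (auto simp: push_mem)

lemma weak_contraction_contract:
  "weighted_config M d c \<Longrightarrow> x \<in> M \<Longrightarrow> y \<in> M \<Longrightarrow> d (weak_contraction c x) (weak_contraction c y) \<le> d x y"
proof (induction c arbitrary: x y)
  case (Cons a c)
  then have "d (weak_contraction (a # c) x) (weak_contraction (a # c) y)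
      \<le> d (push (fst a) (snd a) x) (push (fst a) (snd a) y)"
    by (simp add: push_mem)
  also have "\<dots> \<le> d x y" using Cons.prems by (simp add: push_contract)
  finally show ?case .
qed simp

lemma weak_contraction_displacement:
  "weighted_config M d c \<Longrightarrow> x \<in> M \<Longrightarrow> d x (weak_contraction c x) \<le> (\<Sum>a\<leftarrow>c. snd a)"
proof (induction c arbitrary: x)
  case (Cons a c)
  let ?y = "push (fst a) (snd a) x"
  have y: "?y \<in> M" "d x ?y = snd a" using Cons.prems by (simp_all add: push_mem dist_push)
  have "d x (weak_contraction c ?y) \<le> d x ?y + d ?y (weak_contraction c ?y)"
    using Cons.prems y weak_contraction_mem by (intro triangle) auto
  then show ?case using Cons.IH[OF _ y(1)] Cons.prems y(2) by simp
qed simp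

section \<open>Fixed points by way of the asymptotic centre of an orbit\<close>

lemma fixed_point_if_bounded_orbit:
  assumes f: "\<And>x. x \<in> M \<Longrightarrow> f x \<in> M" "\<And>x y. x \<in> M \<Longrightarrow> y \<in> M \<Longrightarrow> d (f x) (f y) \<le> d x y"
    and a: "a \<in> M" and bdd: "\<And>n. d a ((f ^^ n) a) \<le> C"
  shows "\<exists>x\<in>M. f x = x"
proof -
  define s where "s n = (f ^^ n) a" for n
  have sM: "s n \<in> M" for n unfolding s_def using f(1) a by (induction n) auto
  \<comment> \<open>A sublevel set of the upper limit of squared distances to the orbit, up to the
    boundary value; \<open>r\<close> below is the squared asymptotic radius.\<close>
  define E where "E c = {x \<in> M. \<forall>\<^sub>F n in sequentially. (d x (s n))\<^sup>2 \<le> c}" for c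
  define r where "r = Inf {c. E c \<noteq> {}}"
  have E_nonneg: "0 \<le> c" if Ec: "E c \<noteq> {}" for c
  proof -
    obtain x where "\<forall>\<^sub>F n in sequentially. (d x (s n))\<^sup>2 \<le> c" using Ec by (auto simp: E_def)
    then obtain n where "(d x (s n))\<^sup>2 \<le> c" using eventually_happens' sequentially_bot by blast
    then show ?thesis by (meson order_trans zero_le_power2)
  qed
  have bb: "bdd_below {c. E c \<noteq> {}}" using E_nonneg by (intro bdd_belowI[of _ 0]) auto
  have "a \<in> E (C\<^sup>2)"
    using a bdd by (auto simp: E_def s_def intro!: always_eventually power_mono)
  then have ne: "{c. E c \<noteq> {}} \<noteq> {}" by blast
  have E_mono: "x \<in> E c'" if "x \<in> E c" "c \<le> c'" for x c c'
    using that by (auto simp: E_def elim: eventually_mono)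
  \<comment> \<open>Applying \<open>f\<close> shifts the orbit by one index, which does not affect
    an eventual bound.\<close>
  have E_f: "f x \<in> E c" if "x \<in> E c" for x c
  proof -
    have xM: "x \<in> M" using that by (simp add: E_def)
    have "\<forall>\<^sub>F n in sequentially. (d x (s n))\<^sup>2 \<le> c" using that by (simp add: E_def)
    then have "\<forall>\<^sub>F n in sequentially. (d (f x) (s (Suc n)))\<^sup>2 \<le> c"
    proof eventually_elim
      case (elim n)
      have "d (f x) (s (Suc n)) \<le> d x (s n)" using f(2)[OF xM sM[of n]] by (simp add: s_def)
      then have "(d (f x) (s (Suc n)))\<^sup>2 \<le> (d x (s n))\<^sup>2" by (intro power_mono) auto
      with elim show ?case by linarith
    qed
    then have "\<forall>\<^sub>F n in sequentially. (d (f x) (s n))\<^sup>2 \<le> c"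
      by (rule eventually_sequentially_Suc[THEN iffD1])
    then show ?thesis using f(1)[OF xM] by (simp add: E_def)
  qed
  \<comment> \<open>By Stewart's inequality the midpoint of \<open>x\<close> and \<open>y\<close>
    lies in \<open>E (c - (d x y)\<^sup>2 / 4)\<close>, and no level below \<open>r\<close> is
    occupied. The sets \<open>E c\<close> thus shrink as \<open>c\<close> decreases to
    \<open>r\<close>.\<close>
  have E_diam: "(d x y)\<^sup>2 \<le> 4 * (c - r)" if "x \<in> E c" "y \<in> E c" for x y c
  proof -
    have xy: "x \<in> M" "y \<in> M" using that by (auto simp: E_def)
    then obtain m where m: "between x y (1/2) m" using between_ex[of x y "1/2"] by auto
    have "\<forall>\<^sub>F n in sequentially. (d x (s n))\<^sup>2 \<le> c" "\<forall>\<^sub>F n in sequentially. (d y (s n))\<^sup>2 \<le> c"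
      using that by (auto simp: E_def)
    then have "\<forall>\<^sub>F n in sequentially. (d m (s n))\<^sup>2 \<le> c - (d x y)\<^sup>2 / 4"
    proof eventually_elim
      case (elim n)
      have "(d (s n) m)\<^sup>2 \<le> (1 - 1/2) * (d (s n) x)\<^sup>2 + 1/2 * (d (s n) y)\<^sup>2 - 1/2 * (1 - 1/2) * (d x y)\<^sup>2"
        using xy m sM by (intro stewart) auto
      with elim show ?case
        using commute[of "s n" m] commute[of "s n" x] commute[of "s n" y] by (simp add: field_simps)
    qed
    then have "m \<in> E (c - (d x y)\<^sup>2 / 4)" using m by (simp add: E_def between_def)
    then have "r \<le> c - (d x y)\<^sup>2 / 4" unfolding r_def using bb by (intro cInf_lower) auto
    then show ?thesis by simp
  qed
  have "\<exists>x. x \<in> E (r + inverse (Suc n))" for n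
  proof -
    have "Inf {c. E c \<noteq> {}} < r + inverse (Suc n)" by (simp add: r_def)
    then obtain c where "E c \<noteq> {}" "c < r + inverse (Suc n)"
      using cInf_less_iff[OF ne bb] by auto
    then show ?thesis using E_mono by (meson ex_in_conv less_imp_le)
  qed
  then obtain x where x: "\<And>n. x n \<in> E (r + inverse (Suc n))" by metis
  have xM: "x n \<in> M" for n using x by (auto simp: E_def)
  obtain l where l: "l \<in> M" "(\<lambda>n. d (x n) l) \<longlonglongrightarrow> 0"
  proof (rule converges[of x])
    show "range x \<subseteq> M" using xM by auto
    fix \<epsilon> :: real assume \<epsilon>: "\<epsilon> > 0"
    then obtain N where N: "inverse (real (Suc N)) < (\<epsilon> / 2)\<^sup>2"
      using reals_Archimedean[of "(\<epsilon> / 2)\<^sup>2"] by auto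
    have "x n \<in> E (r + inverse (Suc N))" if "n \<ge> N" for n
    proof (rule E_mono[OF x])
      have "inverse (real (Suc n)) \<le> inverse (real (Suc N))" using that by (intro le_imp_inverse_le) auto
      then show "r + inverse (real (Suc n)) \<le> r + inverse (real (Suc N))" by simp
    qed
    then have "(d (x m) (x n))\<^sup>2 < \<epsilon>\<^sup>2" if "m \<ge> N" "n \<ge> N" for m n
      using E_diam[of "x m" "r + inverse (Suc N)" "x n"] that N by (simp add: power_divide)
    then have "d (x m) (x n) < \<epsilon>" if "m \<ge> N" "n \<ge> N" for m n
      using that \<epsilon> by (meson less_imp_le power_less_imp_less_base)
    then show "\<exists>N. \<forall>m\<ge>N. \<forall>n\<ge>N. d (x m) (x n) < \<epsilon>" by blast
  qed
  \<comment> \<open>Both \<open>x n\<close> and \<open>f (x n)\<close> lie in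
    \<open>E (r + inverse (Suc n))\<close>, whose diameter tends to \<open>0\<close>;
    \<open>l\<close> and \<open>f l\<close> are compared through them.\<close>
  have "d l (f l) \<le> 0"
  proof (rule tendsto_lowerbound)
    have "(\<lambda>n. d (x n) l + sqrt (4 * inverse (Suc n)) + d (x n) l) \<longlonglongrightarrow> 0 + sqrt (4 * 0) + 0"
      by (intro tendsto_intros l LIMSEQ_inverse_real_of_nat)
    then show "(\<lambda>n. d (x n) l + sqrt (4 * inverse (Suc n)) + d (x n) l) \<longlonglongrightarrow> 0" by simp
    have "d l (f l) \<le> d (x n) l + sqrt (4 * inverse (Suc n)) + d (x n) l" for n
    proof -
      have "(d (x n) (f (x n)))\<^sup>2 \<le> 4 * inverse (Suc n)"
        using E_diam[OF x E_f[OF x], of n] by simp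
      then have "d (x n) (f (x n)) \<le> sqrt (4 * inverse (Suc n))" by (rule real_le_rsqrt)
      moreover have "d l (f l) \<le> d l (x n) + d (x n) (f l)" "d (x n) (f l) \<le> d (x n) (f (x n)) + d (f (x n)) (f l)"
        using triangle xM l(1) f(1) by blast+
      ultimately show ?thesis using f(2)[OF xM l(1), of n] commute[of l "x n"] by linarith
    qed
    then show "\<forall>\<^sub>F n in sequentially. d l (f l) \<le> d (x n) l + sqrt (4 * inverse (Suc n)) + d (x n) l"
      by simp
  qed simp
  then have "f l = l" using zero[OF l(1) f(1)[OF l(1)]] nonneg[of l "f l"] by simp
  with l(1) show ?thesis by blast
qed

text \<open>With \<open>p\<close> and \<open>q\<close> at distance \<open>S\<close> on the rays from
  \<open>y\<close> and \<open>a\<close>, the quadrilateral \<open>a y p q\<close> has two sides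
  \<open>S\<close> and \<open>d q p \<le> d a y\<close>; this bounds the diagonal
  \<open>d a p\<close>. Stewart's inequality then moves back from \<open>p\<close> to the point at
  distance \<open>m\<close> from \<open>y\<close>. The last bracket is the numerator of the
  comparison cosine at \<open>a\<close>.\<close>

lemma dist_push_le:
  assumes \<xi>: "\<xi> \<in> boundary M d" and a: "a \<in> M" and y: "y \<in> M" and m: "0 \<le> m" "m \<le> S" "0 < S"
  shows "(d a (push \<xi> m y))\<^sup>2
    \<le> (d a y)\<^sup>2 + m\<^sup>2 + m / S * (S\<^sup>2 + (d a y)\<^sup>2 - (d y (ray_from a \<xi> S))\<^sup>2)"
proof -
  define p where "p = ray_from y \<xi> S"
  define q where "q = ray_from a \<xi> S"
  have pq: "p \<in> M" "q \<in> M" "d y p = S" "d a q = S" "d q p \<le> d a y"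
    using \<xi> a y m by (simp_all add: p_def q_def ray_from_mem ray_from_dist_start ray_from_contract)
  have "(d a p)\<^sup>2 + (d y q)\<^sup>2 \<le> (d a y)\<^sup>2 + S\<^sup>2 + (d q p)\<^sup>2 + S\<^sup>2"
    using quadrilateral[OF a y pq(1,2)] pq(3,4) commute[of q a] commute[of p q] by simp
  moreover have "(d q p)\<^sup>2 \<le> (d a y)\<^sup>2"
    using pq(5) by (intro power_mono) auto
  ultimately have "(d a p)\<^sup>2 \<le> 2 * (d a y)\<^sup>2 + 2 * S\<^sup>2 - (d y q)\<^sup>2"
    by linarith
  then have "m / S * (d a p)\<^sup>2 \<le> m / S * (2 * (d a y)\<^sup>2 + 2 * S\<^sup>2 - (d y q)\<^sup>2)"
    using m by (intro mult_left_mono) auto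
  moreover have "(d a (push \<xi> m y))\<^sup>2
      \<le> (1 - m / S) * (d a y)\<^sup>2 + m / S * (d a p)\<^sup>2 - m / S * (1 - m / S) * (d y p)\<^sup>2"
    unfolding push_def p_def using \<xi> a y m pq(1)
    by (intro stewart ray_from_between) (auto simp: p_def)
  moreover have "m / S * (1 - m / S) * (d y p)\<^sup>2 = m * S - m\<^sup>2"
    using m by (simp add: pq(3) power2_eq_square field_simps)
  moreover have "m / S * (2 * (d a y)\<^sup>2 + 2 * S\<^sup>2 - (d y q)\<^sup>2)
      = m / S * (S\<^sup>2 + (d a y)\<^sup>2 - (d y q)\<^sup>2) + m / S * (d a y)\<^sup>2 + m * S"
    using m by (simp add: power2_eq_square field_simps)
  ultimately show ?thesis unfolding q_def[symmetric] by (simp add: left_diff_distrib)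
qed

text \<open>Here \<open>y\<close> is an intermediate point near the starting point \<open>x\<close>,
  and the cosine is taken at \<open>x\<close> instead of \<open>y\<close>. The error, of order
  \<open>d a x\<close>, is multiplied by \<open>m / d a x\<close> and becomes independent of
  \<open>x\<close>.\<close>

lemma dist_push_le_comparison_cos:
  assumes \<xi>: "\<xi> \<in> boundary M d" and a: "a \<in> M" and x: "x \<in> M" and y: "y \<in> M" and m: "0 \<le> m" "m \<le> L"
    and L: "d x y \<le> L" "L \<le> d a x" "0 < d a x"
  shows "(d a (push \<xi> m y))\<^sup>2 \<le> (d a y)\<^sup>2 + (m\<^sup>2 + 7 * L * m)
    + 2 * d a x * (m * comparison_cos d a (ray_from a \<xi> (d a x)) x)"
proof -
  define S where "S = d a x"
  define q where "q = ray_from a \<xi> S"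
  have S: "0 < S" "L \<le> S" using L by (auto simp: S_def)
  have L0: "0 \<le> L" using m by simp
  have q: "q \<in> M" "d a q = S"
    using \<xi> a S by (simp_all add: q_def ray_from_mem ray_from_dist_start)
  have "d a y \<le> S + L" unfolding S_def using triangle[OF a x y] L(1) by linarith
  then have "(d a y)\<^sup>2 \<le> (S + L)\<^sup>2" by (intro power_mono) auto
  moreover have "L * L \<le> L * S" using L0 S by (intro mult_left_mono)
  ultimately have day: "(d a y)\<^sup>2 \<le> S\<^sup>2 + 3 * S * L"
    by (simp add: power2_eq_square algebra_simps)
  have xq: "d x q \<le> 2 * S" using triangle''[OF x a q(1)] q(2) by (simp add: S_def)
  have "(d x q)\<^sup>2 - (d y q)\<^sup>2 \<le> 4 * S * L"
  proof (cases "d y q \<le> d x q")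
    case True
    have "d x q - d y q \<le> L" using triangle[OF x y q(1)] L(1) by linarith
    then have "(d x q - d y q) * (d x q + d y q) \<le> L * (2 * S + 2 * S)"
      using True xq L0 by (intro mult_mono) auto
    then show ?thesis by (simp add: power2_eq_square algebra_simps)
  next
    case False
    then have "(d x q)\<^sup>2 \<le> (d y q)\<^sup>2" by (intro power_mono) auto
    moreover have "0 \<le> 4 * S * L" using L0 S by simp
    ultimately show ?thesis by linarith
  qed
  \<comment> \<open>The constant is 3 + 4: \<open>3 * S * L\<close> for replacing
    \<open>d a y\<close> by \<open>d a x\<close>, and \<open>4 * S * L\<close> for replacing
    \<open>d y q\<close> by \<open>d x q\<close>.\<close>
  with day have "S\<^sup>2 + (d a y)\<^sup>2 - (d y q)\<^sup>2 \<le> 2 * S\<^sup>2 - (d x q)\<^sup>2 + 7 * S * L" by simp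
  then have "m / S * (S\<^sup>2 + (d a y)\<^sup>2 - (d y q)\<^sup>2) \<le> m / S * (2 * S\<^sup>2 - (d x q)\<^sup>2 + 7 * S * L)"
    using m S by (intro mult_left_mono) auto
  also have "\<dots> = 7 * L * m + 2 * S * (m * comparison_cos d a q x)"
    using S by (simp add: comparison_cos_def q(2) S_def[symmetric] commute[of q x])
       (simp add: field_simps power2_eq_square)
  finally show ?thesis
    using dist_push_le[OF \<xi> a y m(1) _ S(1)] m(2) S(2)
    unfolding S_def[symmetric] q_def[symmetric] by fastforce
qed

text \<open>The induction fixes \<open>x\<close> and varies the current point \<open>y\<close>. The
  distance from \<open>x\<close> plus the weights still to come stays at most \<open>L\<close>, so
  every intermediate point is within \<open>L\<close> of \<open>x\<close>, and the error terms add
  up to a constant.\<close>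

lemma dist_weak_contraction_le:
  assumes a: "a \<in> M" and x: "x \<in> M" and L: "L \<le> d a x" "0 < d a x"
  shows "\<lbrakk>weighted_config M d c; y \<in> M; d x y + (\<Sum>z\<leftarrow>c. snd z) \<le> L\<rbrakk> \<Longrightarrow>
    (d a (weak_contraction c y))\<^sup>2 \<le> (d a y)\<^sup>2 + (\<Sum>z\<leftarrow>c. (snd z)\<^sup>2 + 7 * L * snd z)
      + 2 * d a x * (\<Sum>z\<leftarrow>c. snd z * comparison_cos d a (ray_from a (fst z) (d a x)) x)"
proof (induction c arbitrary: y)
  case (Cons z c)
  define y' where "y' = push (fst z) (snd z) y"
  have y': "y' \<in> M" "d y y' = snd z"
    using Cons.prems by (simp_all add: y'_def push_mem dist_push)
  have s0: "0 \<le> (\<Sum>z\<leftarrow>c. snd z)"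
    using Cons.prems(1) by (intro sum_list_nonneg) (auto simp: weighted_config_def)
  have "d x y' \<le> d x y + snd z" using triangle[OF x Cons.prems(2) y'(1)] y'(2) by simp
  then have "(d a (weak_contraction c y'))\<^sup>2 \<le> (d a y')\<^sup>2 + (\<Sum>z\<leftarrow>c. (snd z)\<^sup>2 + 7 * L * snd z)
      + 2 * d a x * (\<Sum>z\<leftarrow>c. snd z * comparison_cos d a (ray_from a (fst z) (d a x)) x)"
    using Cons.prems y' by (intro Cons.IH) auto
  moreover have "(d a y')\<^sup>2 \<le> (d a y)\<^sup>2 + ((snd z)\<^sup>2 + 7 * L * snd z)
      + 2 * d a x * (snd z * comparison_cos d a (ray_from a (fst z) (d a x)) x)"
    unfolding y'_def
  proof (rule dist_push_le_comparison_cos[OF _ a x])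
    show "snd z \<le> L" "d x y \<le> L"
      using Cons.prems s0 nonneg[of x y] by (auto simp del: nonneg)
  qed (use Cons.prems L in auto)
  ultimately show ?case by (simp add: y'_def[symmetric] distrib_left)
qed simp

lemma escaping_sequence:
  assumes c: "weighted_config M d c" and a: "a \<in> M" and no_fp: "\<And>x. x \<in> M \<Longrightarrow> weak_contraction c x \<noteq> x"
  obtains x where "\<And>k. x k \<in> M" "\<And>k. real k \<le> d a (x k)"
    "\<And>k. d a (x k) \<le> d a (weak_contraction c (x k))"
proof -
  define f where "f = weak_contraction c"
  define L where "L = (\<Sum>z\<leftarrow>c. snd z)"
  have f: "f x \<in> M" if "x \<in> M" for x using weak_contraction_mem[OF c that] by (simp add: f_def)
  have fM: "(f ^^ n) a \<in> M" for n using f a by (induction n) auto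
  have unbdd: "\<exists>n. C < d a ((f ^^ n) a)" for C
  proof (rule ccontr)
    assume "\<nexists>n. C < d a ((f ^^ n) a)"
    then have "\<exists>x\<in>M. f x = x"
      using f a weak_contraction_contract[OF c]
      by (intro fixed_point_if_bounded_orbit[where a = a and C = C]) (auto simp: f_def not_less)
    then show False using no_fp by (auto simp: f_def)
  qed
  have L0: "0 \<le> L" using order_trans[OF nonneg weak_contraction_displacement[OF c a]] by (simp add: L_def)
  have "\<exists>x\<in>M. real k \<le> d a x \<and> d a x \<le> d a (f x)" for k
  proof -
    \<comment> \<open>At the first passage beyond \<open>k + L\<close> the preceding point is still
      within \<open>k + L\<close>, so this step does not decrease the distance from
      \<open>a\<close>. As a step has length at most \<open>L\<close>, the preceding point is at
      distance at least \<open>k\<close>.\<close>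
    define n where "n = (LEAST n. real k + L < d a ((f ^^ n) a))"
    have n: "real k + L < d a ((f ^^ n) a)"
      unfolding n_def using unbdd by (rule LeastI_ex)
    then have "n \<noteq> 0" using a L0 by (intro notI) simp
    then obtain j where j: "n = Suc j" using not0_implies_Suc by blast
    let ?x = "(f ^^ j) a"
    have "\<not> (real k + L < d a ?x)"
      using not_less_Least[of j "\<lambda>n. real k + L < d a ((f ^^ n) a)"] j by (simp add: n_def)
    moreover have "d a (f ?x) \<le> d a ?x + L"
      using triangle[OF a fM f[OF fM], of j j] weak_contraction_displacement[OF c fM, of j]
      by (simp add: f_def L_def)
    ultimately show ?thesis using n fM[of j] by (intro bexI[of _ ?x]) (auto simp: j)
  qed
  then obtain x where "\<And>k. x k \<in> M \<and> real k \<le> d a (x k) \<and> d a (x k) \<le> d a (f (x k))" by metis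
  then show ?thesis by (intro that[of x]) (auto simp: f_def)
qed

text \<open>The vertices are the images of \<open>x\<close> under the initial parts of the
  composition. Each side has the positive weight as its length, and the fixed-point equation closes
  the polygon.\<close>

lemma fixed_point_polygon:
  assumes c: "weighted_config M d c" and x: "x \<in> M" "weak_contraction c x = x"
  shows "\<exists>p. polygon M p \<and> gauss_map d c p"
proof -
  let ?n = "length c"
  define y where "y i = weak_contraction (take i c) x" for i
  define p where "p = map y [0..<?n]"
  have yM: "y i \<in> M" for i
    unfolding y_def using c x(1) by (intro weak_contraction_mem) (auto simp: weighted_config_def dest: in_set_takeD)
  have ci: "fst (c ! i) \<in> boundary M d" "0 < snd (c ! i)" if "i < ?n" for i
    using c nth_mem[OF that] by (auto simp: weighted_config_def)
  have y_Suc: "y (Suc i) = push (fst (c ! i)) (snd (c ! i)) (y i)" if "i < ?n" for i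
    using that by (simp add: y_def take_Suc_conv_app_nth)
  have p: "p ! i = y i" "p ! (Suc i mod length p) = y (Suc i)" if "i < ?n" for i
  proof -
    show "p ! i = y i" using that by (simp add: p_def)
    show "p ! (Suc i mod length p) = y (Suc i)"
    \<comment> \<open>At the last index the successor wraps around to \<open>y 0 = x\<close>, which
      equals \<open>y ?n\<close> because \<open>x\<close> is fixed.\<close>
    proof (cases "Suc i = ?n")
      case True
      moreover have "0 < ?n" using that by linarith
      ultimately have "p ! (Suc i mod length p) = y 0" by (simp add: p_def)
      also have "\<dots> = y ?n" using x(2) by (simp add: y_def)
      finally show ?thesis using \<open>Suc i = ?n\<close> by simp
    qed (use that in \<open>simp add: p_def\<close>)
  qed
  have d: "d (y i) (y (Suc i)) = snd (c ! i)" if "i < ?n" for i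
    unfolding y_Suc[OF that] using ci[OF that] yM by (intro dist_push) auto
  have len: "length p = ?n" by (simp add: p_def)
  have "polygon M p"
    unfolding polygon_def
  proof (intro conjI allI impI)
    show "set p \<subseteq> M" using yM by (auto simp: p_def)
    fix i assume "i < length p"
    then have i: "i < ?n" by (simp add: len)
    have "y i \<noteq> y (Suc i)" using d[OF i] ci(2)[OF i] yM by (metis less_irrefl zero)
    then show "p ! i \<noteq> p ! (Suc i mod length p)" using p[OF i] by simp
  qed
  moreover have "gauss_map d c p"
    unfolding gauss_map_def
  proof (intro conjI allI impI)
    show "?n = length p" by (simp add: len)
    fix i assume "i < length p"
    then have i: "i < ?n" by (simp add: len)
    show "p ! (Suc i mod length p) \<in> ray_from (p ! i) (fst (c ! i)) ` {0..}"
      unfolding p[OF i] y_Suc[OF i] push_def using ci(2)[OF i] by (intro imageI) auto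
    show "snd (c ! i) = d (p ! i) (p ! (Suc i mod length p))"
      unfolding p[OF i] using d[OF i] by simp
  qed
  ultimately show ?thesis by blast
qed

end

section \<open>Ultralimits\<close>

text \<open>Compactness gives a cluster point \<open>l\<close> of the image filter. An ultrafilter
  that does not almost surely avoid a neighbourhood of \<open>l\<close> almost surely hits it, so
  \<open>l\<close> is a limit.\<close>

lemma ultrafilter_tendsto:
  fixes f :: "nat \<Rightarrow> real"
  assumes "nonprincipal_ultrafilter \<omega>" "\<forall>\<^sub>F n in \<omega>. \<bar>f n\<bar> \<le> C"
  obtains l where "(f \<longlongrightarrow> l) \<omega>"
proof -
  have "compact {-C..C}" by simp
  moreover have "filtermap f \<omega> \<noteq> bot"
    using assms(1) by (simp add: nonprincipal_ultrafilter_def filtermap_bot_iff)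
  moreover have "\<forall>\<^sub>F y in filtermap f \<omega>. y \<in> {-C..C}"
    using assms(2) by (simp add: eventually_filtermap abs_le_iff minus_le_iff conj_commute)
  ultimately obtain l where l: "inf (nhds l) (filtermap f \<omega>) \<noteq> bot"
    unfolding compact_filter by blast
  have "(f \<longlongrightarrow> l) \<omega>"
  proof (rule topological_tendstoI)
    fix S assume S: "open S" "l \<in> S"
    have "\<not> (\<forall>\<^sub>F n in \<omega>. f n \<notin> S)"
    proof
      assume "\<forall>\<^sub>F n in \<omega>. f n \<notin> S"
      then have "\<forall>\<^sub>F y in filtermap f \<omega>. y \<notin> S" by (simp add: eventually_filtermap)
      moreover have "\<forall>\<^sub>F y in nhds l. y \<in> S" using S by (rule eventually_nhds_in_open)
      ultimately have "\<forall>\<^sub>F y in inf (nhds l) (filtermap f \<omega>). False"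
        unfolding eventually_inf by blast
      then show False using l by (simp add: eventually_False)
    qed
    then show "\<forall>\<^sub>F n in \<omega>. f n \<in> S"
      using assms(1) by (auto simp: nonprincipal_ultrafilter_def)
  qed
  then show ?thesis by (rule that)
qed

text \<open>An ultrafilter containing a singleton would be principal; hence every single index can
  be removed, and by induction every initial segment.\<close>

lemma nonprincipal_ultrafilter_le_sequentially:
  assumes "nonprincipal_ultrafilter \<omega>"
  shows "\<omega> \<le> sequentially"
proof -
  have ultra: "eventually P \<omega> \<or> eventually (\<lambda>n. \<not> P n) \<omega>" and nb: "\<omega> \<noteq> bot" and np: "\<omega> \<noteq> principal {n}" for P n
    using assms by (auto simp: nonprincipal_ultrafilter_def)
  have ne: "\<forall>\<^sub>F n in \<omega>. n \<noteq> k" for k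
  proof (rule ccontr)
    assume "\<not> (\<forall>\<^sub>F n in \<omega>. n \<noteq> k)"
    then have k: "\<forall>\<^sub>F n in \<omega>. n = k" using ultra[of "\<lambda>n. n = k"] by auto
    have "\<omega> = principal {k}"
    proof (rule filter_eqI)
      fix P
      have "eventually P \<omega> \<longleftrightarrow> P k"
      proof
        assume "eventually P \<omega>"
        with k have "\<forall>\<^sub>F n in \<omega>. P k" by eventually_elim auto
        then show "P k" using nb by (simp add: eventually_const_iff)
      next
        assume "P k" then show "eventually P \<omega>" using k by (auto elim: eventually_mono)
      qed
      then show "eventually P \<omega> \<longleftrightarrow> eventually P (principal {k})"
        by (simp add: eventually_principal)
    qed
    with np show False by blast
  qed
  have "\<forall>\<^sub>F n in \<omega>. N \<le> n" for N
  proof (induction N)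
    case (Suc N)
    with ne[of N] show ?case by eventually_elim auto
  qed simp
  then show ?thesis
    unfolding le_filter_def eventually_sequentially by (metis eventually_mono)
qed

section \<open>Hadamard structure of the ultralimit\<close>

locale ultralimit = hadamard M d for M :: "'a set" and d +
  fixes b :: 'a and \<omega> :: "nat filter"
  assumes base: "b \<in> M" and ultrafilter: "nonprincipal_ultrafilter \<omega>"
begin

abbreviation "B \<equiv> bounded_seqs M d b"
abbreviation "R \<equiv> ultra_rel M d b \<omega>"
abbreviation "N \<equiv> ultra_space M d b \<omega>"
abbreviation "e \<equiv> ultra_dist M d b \<omega>"
abbreviation "class u \<equiv> R `` {u}"
abbreviation "emb \<equiv> ultra_embed M d b \<omega>"

lemma nontrivial: "\<omega> \<noteq> bot"
  using ultrafilter by (simp add: nonprincipal_ultrafilter_def)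

lemma seq_mem: "u \<in> B \<Longrightarrow> u n \<in> M"
  by (auto simp: bounded_seqs_def)

lemma seq_bounded:
  assumes "u \<in> B" "v \<in> B"
  obtains C where "\<And>n. d (u n) (v n) \<le> C"
proof -
  obtain C C' where C: "\<And>n. d (u n) b \<le> C" and C': "\<And>n. d (v n) b \<le> C'"
    using assms by (auto simp: bounded_seqs_def)
  have "d (u n) (v n) \<le> C + C'" for n
    using triangle'[of "u n" b "v n"] C[of n] C'[of n] seq_mem assms base by force
  then show ?thesis by (rule that)
qed

lemma const_seq: "x \<in> M \<Longrightarrow> (\<lambda>_. x) \<in> B"
  by (auto simp: bounded_seqs_def)

lemma equiv_ultra_rel: "equiv B R"
proof (rule equivI)
  show "R \<subseteq> B \<times> B" by (auto simp: ultra_rel_def)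
  show "refl_on B R" by (auto simp: refl_on_def ultra_rel_def seq_mem)
  show "sym R" by (auto simp: sym_def ultra_rel_def commute)
  show "trans R"
  proof (rule transI)
    fix u v w assume "(u, v) \<in> R" "(v, w) \<in> R"
    then have uvw: "u \<in> B" "v \<in> B" "w \<in> B" and lim: "((\<lambda>n. d (u n) (v n) + d (v n) (w n)) \<longlongrightarrow> 0) \<omega>"
      by (auto simp: ultra_rel_def intro: tendsto_add_zero)
    have "((\<lambda>n. d (u n) (w n)) \<longlongrightarrow> 0) \<omega>"
      using uvw seq_mem by (intro Lim_null_comparison[OF _ lim] always_eventually allI) (auto intro: triangle)
    with uvw show "(u, w) \<in> R" by (simp add: ultra_rel_def)
  qed
qed

lemma class_mem: "u \<in> B \<Longrightarrow> class u \<in> N"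
  unfolding ultra_space_def by (rule quotientI)

lemma class_cases:
  assumes "U \<in> N"
  obtains u where "u \<in> B" "U = class u"
  using assms unfolding ultra_space_def by (rule quotientE)

lemma class_eq_iff: "u \<in> B \<Longrightarrow> v \<in> B \<Longrightarrow> class u = class v \<longleftrightarrow> ((\<lambda>n. d (u n) (v n)) \<longlongrightarrow> 0) \<omega>"
  using eq_equiv_class_iff[OF equiv_ultra_rel] by (auto simp: ultra_rel_def)

text \<open>Bounded distances converge along \<open>\<omega>\<close>, and other representatives
  change them by a null sequence, so the description in \<open>ultra_dist\<close> denotes this
  limit.\<close>

lemma tendsto_ultra_dist:
  assumes u: "u \<in> B" and v: "v \<in> B"
  shows "((\<lambda>n. d (u n) (v n)) \<longlongrightarrow> e (class u) (class v)) \<omega>"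
proof -
  obtain C where "\<And>n. d (u n) (v n) \<le> C" using seq_bounded u v by metis
  then obtain l where l: "((\<lambda>n. d (u n) (v n)) \<longlongrightarrow> l) \<omega>"
    using ultrafilter_tendsto[OF ultrafilter, of "\<lambda>n. d (u n) (v n)" C] by auto
  have all: "((\<lambda>n. d (u' n) (v' n)) \<longlongrightarrow> l) \<omega>" if "u' \<in> class u" "v' \<in> class v" for u' v'
  proof -
    have uv': "u' \<in> B" "v' \<in> B" and lim: "((\<lambda>n. d (u n) (u' n) + d (v n) (v' n)) \<longlongrightarrow> 0) \<omega>"
      using that by (auto simp: ultra_rel_def intro: tendsto_add_zero)
    have "\<bar>d (u' n) (v' n) - d (u n) (v n)\<bar> \<le> d (u n) (u' n) + d (v n) (v' n)" for n
      using seq_mem[OF u, of n] seq_mem[OF v, of n] seq_mem[OF uv'(1), of n] seq_mem[OF uv'(2), of n]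
        triangle commute by smt
    then have "((\<lambda>n. d (u' n) (v' n) - d (u n) (v n)) \<longlongrightarrow> 0) \<omega>"
      by (intro Lim_null_comparison[OF _ lim]) auto
    from tendsto_add[OF this l] show ?thesis by simp
  qed
  have "u \<in> class u" "v \<in> class v"
    using equiv_class_self[OF equiv_ultra_rel] u v by auto
  then have "(THE l. \<forall>u'\<in>class u. \<forall>v'\<in>class v. ((\<lambda>n. d (u' n) (v' n)) \<longlongrightarrow> l) \<omega>) = l"
    using all l tendsto_unique[OF nontrivial] by (intro the_equality) blast+
  then have "e (class u) (class v) = l"
    using class_mem u v by (simp add: ultra_dist_def)
  with l show ?thesis by simp
qed

lemma ultra_dist_eqI:
  "u \<in> B \<Longrightarrow> v \<in> B \<Longrightarrow> ((\<lambda>n. d (u n) (v n)) \<longlongrightarrow> l) \<omega> \<Longrightarrow> e (class u) (class v) = l"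
  using tendsto_ultra_dist tendsto_unique[OF nontrivial] by blast

lemma metric_space_ultra: "Metric_space N e"
proof
  show "0 \<le> e U V" for U V
  proof (cases "U \<in> N \<and> V \<in> N")
    case True
    then obtain u v where "u \<in> B" "v \<in> B" "U = class u" "V = class v" by (meson class_cases)
    then show ?thesis
      using tendsto_lowerbound[OF tendsto_ultra_dist _ nontrivial] by simp
  qed (auto simp: ultra_dist_def)
  show "e U V = e V U" for U V
  proof (cases "U \<in> N \<and> V \<in> N")
    case True
    then obtain u v where uv: "u \<in> B" "v \<in> B" "U = class u" "V = class v" by (meson class_cases)
    have "(\<lambda>n. d (u n) (v n)) = (\<lambda>n. d (v n) (u n))" by (rule ext) (rule commute)
    then show ?thesis
      unfolding uv(3,4) using ultra_dist_eqI[OF uv(1,2)] tendsto_ultra_dist[OF uv(2,1)] by simp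
  qed (auto simp: ultra_dist_def)
  show "e U V = 0 \<longleftrightarrow> U = V" if UV: "U \<in> N" "V \<in> N" for U V
  proof -
    obtain u v where uv: "u \<in> B" "v \<in> B" "U = class u" "V = class v"
      using UV by (meson class_cases)
    show ?thesis
      unfolding uv(3,4) class_eq_iff[OF uv(1,2)]
    proof
      show "((\<lambda>n. d (u n) (v n)) \<longlongrightarrow> 0) \<omega>" if "e (class u) (class v) = 0"
        using tendsto_ultra_dist[OF uv(1,2)] unfolding that .
    qed (rule ultra_dist_eqI[OF uv(1,2)])
  qed
  show "e U W \<le> e U V + e V W" if UVW: "U \<in> N" "V \<in> N" "W \<in> N" for U V W
  proof -
    obtain u v w where uv: "u \<in> B" "v \<in> B" "w \<in> B" "U = class u" "V = class v" "W = class w"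
      using UVW by (meson class_cases)
    show ?thesis
      unfolding uv using uv(1-3) seq_mem
      by (intro tendsto_le[OF nontrivial tendsto_add[OF tendsto_ultra_dist tendsto_ultra_dist] tendsto_ultra_dist]
          always_eventually allI triangle) auto
  qed
qed

text \<open>The limit is found by a diagonal choice: \<open>v k\<close> is the \<open>k\<close>-th entry of the last \<open>w j\<close>, \<open>j \<le> k\<close>,
  such that the \<open>k\<close>-th entries of \<open>w 0, \<dots>, w j\<close> are as close to each other as their classes are.\<close>

lemma diagonal_limit:
  fixes w :: "nat \<Rightarrow> nat \<Rightarrow> 'a"
  assumes w: "\<And>i. w i \<in> B"
    and close: "\<And>i j. e (class (w i)) (class (w j)) < inverse (Suc i) + inverse (Suc j)"
  obtains v where "v \<in> B" "\<And>i. e (class (w i)) (class v) \<le> 2 * inverse (Suc i)"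
proof -
  define good where "good k j \<longleftrightarrow> (\<forall>i\<le>j. \<forall>i'\<le>j. d (w i k) (w i' k) < inverse (Suc i) + inverse (Suc i'))" for k j
  \<comment> \<open>The index \<open>0\<close> keeps the maximum defined, and
    \<open>good k 0\<close> always holds, so the maximum is itself good.\<close>
  define J where "J k = Max (insert 0 {j. j \<le> k \<and> good k j})" for k
  define v where "v k = w (J k) k" for k
  have good0: "good k 0" for k
    using seq_mem[OF w] by (simp add: good_def)
  have fin: "finite (insert 0 {j. j \<le> k \<and> good k j})" for k by simp
  have J: "good k (J k)" for k
    using Max_in[OF fin[of k]] good0[of k] unfolding J_def[symmetric] by auto
  have vd: "d (w i k) (v k) \<le> 2 * inverse (Suc i)" if "i \<le> k" "good k i" for i k
  proof -
    have "i \<le> J k" unfolding J_def using that by (intro Max_ge) auto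
    then have "d (w i k) (w (J k) k) < inverse (Suc i) + inverse (Suc (J k))"
      using J[of k] by (auto simp: good_def)
    moreover have "inverse (real (Suc (J k))) \<le> inverse (real (Suc i))"
      using \<open>i \<le> J k\<close> by (intro le_imp_inverse_le) auto
    ultimately show ?thesis unfolding v_def by linarith
  qed
  have vM: "v k \<in> M" for k using seq_mem w by (simp add: v_def)
  obtain C where C: "\<And>k. d (w 0 k) b \<le> C" using w[of 0] by (auto simp: bounded_seqs_def)
  \<comment> \<open>The case \<open>i = 0\<close> of \<open>vd\<close> keeps \<open>v\<close> within
    \<open>2\<close> of the bounded sequence \<open>w 0\<close>.\<close>
  have "d (v k) b \<le> 2 + C" for k
    using triangle''[of "v k" "w 0 k" b] vd[of 0 k] good0[of k] C[of k] vM base seq_mem[OF w] by force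
  then have vB: "v \<in> B" using vM by (auto simp: bounded_seqs_def)
  have ev: "\<forall>\<^sub>F k in \<omega>. d (w i k) (w j k) < inverse (Suc i) + inverse (Suc j)" for i j
    using order_tendstoD(2)[OF tendsto_ultra_dist close] w by blast
  \<comment> \<open>For fixed \<open>i\<close>, \<open>good k i\<close> is a finite conjunction of
    conditions on \<open>k\<close>, each valid \<open>\<omega>\<close>-almost everywhere.\<close>
  have "e (class (w i)) (class v) \<le> 2 * inverse (Suc i)" for i
  proof (rule tendsto_upperbound[OF tendsto_ultra_dist _ nontrivial])
    have "\<forall>\<^sub>F k in \<omega>. \<forall>j\<in>{..i}. \<forall>j'\<in>{..i}. d (w j k) (w j' k) < inverse (Suc j) + inverse (Suc j')"
      by (intro eventually_ball_finite ballI ev finite_atMost)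
    moreover have "\<forall>\<^sub>F k in \<omega>. i \<le> k"
      using nonprincipal_ultrafilter_le_sequentially[OF ultrafilter] eventually_ge_at_top
      by (rule filter_leD)
    ultimately show "\<forall>\<^sub>F k in \<omega>. d (w i k) (v k) \<le> 2 * inverse (Suc i)"
    proof eventually_elim
      case (elim k)
      then show ?case by (intro vd) (auto simp: good_def)
    qed
  qed (use w vB in auto)
  with vB show ?thesis by (rule that)
qed

text \<open>The terms \<open>\<sigma> (k i)\<close>, with tails of size
  \<open>inverse (Suc i)\<close>, are represented by sequences and passed to
  \<open>diagonal_limit\<close>; the class obtained then attracts the whole Cauchy sequence.\<close>

lemma mcomplete_ultra: "Metric_space.mcomplete N e"
proof -
  interpret U: Metric_space N e by (rule metric_space_ultra)
  show ?thesis
    unfolding U.mcomplete_def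
  proof (intro allI impI)
    fix \<sigma> assume "U.MCauchy \<sigma>"
    then have \<sigma>N: "\<sigma> n \<in> N" and \<sigma>: "0 < \<epsilon> \<Longrightarrow> \<exists>k. \<forall>m\<ge>k. \<forall>n\<ge>k. e (\<sigma> m) (\<sigma> n) < \<epsilon>" for n \<epsilon>
      by (auto simp: U.MCauchy_def)
    have "\<exists>k. \<forall>m\<ge>k. \<forall>n\<ge>k. e (\<sigma> m) (\<sigma> n) < inverse (Suc i)" for i
      using \<sigma>[of "inverse (Suc i)"] by simp
    then obtain k where k: "\<And>i m n. m \<ge> k i \<Longrightarrow> n \<ge> k i \<Longrightarrow> e (\<sigma> m) (\<sigma> n) < inverse (Suc i)"
      by metis
    have "\<exists>w. w \<in> B \<and> \<sigma> (k i) = class w" for i using \<sigma>N by (meson class_cases)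
    then obtain w where w: "\<And>i. w i \<in> B" "\<And>i. \<sigma> (k i) = class (w i)" by metis
    have "e (class (w i)) (class (w j)) < inverse (Suc i) + inverse (Suc j)" for i j
    proof -
      let ?n = "max (k i) (k j)"
      have "e (\<sigma> (k i)) (\<sigma> (k j)) \<le> e (\<sigma> (k i)) (\<sigma> ?n) + e (\<sigma> (k j)) (\<sigma> ?n)"
        using U.triangle'[OF \<sigma>N \<sigma>N \<sigma>N] .
      then show ?thesis using k[of i "k i" ?n] k[of j "k j" ?n] unfolding w(2) by force
    qed
    then obtain v where v: "v \<in> B" "\<And>i. e (class (w i)) (class v) \<le> 2 * inverse (Suc i)"
      using diagonal_limit w(1) by metis
    have "limitin U.mtopology \<sigma> (class v) sequentially"
      unfolding U.limit_metric_sequentially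
    proof (intro conjI allI impI)
      fix \<epsilon> :: real assume "0 < \<epsilon>"
      \<comment> \<open>One third serves the Cauchy tail beyond \<open>k i\<close>, two thirds the
        bound \<open>2 * inverse (Suc i)\<close>.\<close>
      then obtain i where i: "inverse (real (Suc i)) < \<epsilon> / 3"
        using reals_Archimedean[of "\<epsilon> / 3"] by auto
      have "e (\<sigma> n) (class v) < \<epsilon>" if "n \<ge> k i" for n
        using U.triangle[OF \<sigma>N \<sigma>N class_mem[OF v(1)], of n "k i"] k[OF that order_refl] v(2)[of i] i
        unfolding w(2) by linarith
      then show "\<exists>K. \<forall>n\<ge>K. \<sigma> n \<in> N \<and> e (\<sigma> n) (class v) < \<epsilon>" using \<sigma>N by blast
    qed (rule class_mem[OF v(1)])
    then show "\<exists>x. limitin U.mtopology \<sigma> x sequentially" by blast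
  qed
qed

text \<open>The dividing points are chosen entry by entry, and Stewart's inequality passes to the
  limit along \<open>\<omega>\<close>.\<close>

lemma hadamard_ultra: "hadamard N e"
proof -
  interpret U: Metric_space N e by (rule metric_space_ultra)
  show ?thesis
  proof (unfold_locales, rule mcomplete_ultra)
    fix X Y :: "(nat \<Rightarrow> 'a) set" and l :: real
    assume "X \<in> N" "Y \<in> N" and l: "0 \<le> l" "l \<le> 1"
    then obtain x y where xy: "x \<in> B" "y \<in> B" "X = class x" "Y = class y" by (meson class_cases)
    have "\<exists>p\<in>M. \<forall>z\<in>M. (d z p)\<^sup>2 \<le> (1 - l) * (d z (x n))\<^sup>2 + l * (d z (y n))\<^sup>2 - l * (1 - l) * (d (x n) (y n))\<^sup>2" for n
      using stewart_point seq_mem xy(1,2) l by blast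
    then obtain p where pM: "\<And>n. p n \<in> M" and p: "\<And>z n. z \<in> M \<Longrightarrow>
        (d z (p n))\<^sup>2 \<le> (1 - l) * (d z (x n))\<^sup>2 + l * (d z (y n))\<^sup>2 - l * (1 - l) * (d (x n) (y n))\<^sup>2"
      by metis
    obtain C where C: "\<And>n. d (x n) b \<le> C" "\<And>n. d (y n) b \<le> C"
    proof -
      obtain C1 C2 where "\<And>n. d (x n) b \<le> C1" "\<And>n. d (y n) b \<le> C2"
        using xy(1,2) by (auto simp: bounded_seqs_def)
      then show ?thesis by (intro that[of "max C1 C2"]) (auto simp: le_max_iff_disj)
    qed
    \<comment> \<open>Stewart's inequality seen from \<open>b\<close> keeps the chosen points in the
      ball containing \<open>x n\<close> and \<open>y n\<close>, so they represent a point of the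
      ultralimit.\<close>
    have "d (p n) b \<le> C" for n
    proof (rule power2_le_imp_le)
      show "0 \<le> C" using C(1)[of 0] nonneg order_trans by blast
      have "(d b (p n))\<^sup>2 \<le> (1 - l) * (d b (x n))\<^sup>2 + l * (d b (y n))\<^sup>2 - l * (1 - l) * (d (x n) (y n))\<^sup>2"
        by (rule p[OF base])
      also have "\<dots> \<le> (1 - l) * C\<^sup>2 + l * C\<^sup>2 - 0"
        using l C by (intro diff_mono add_mono mult_left_mono power_mono) (auto simp: commute)
      finally show "(d (p n) b)\<^sup>2 \<le> C\<^sup>2" by (simp add: commute algebra_simps)
    qed
    then have pB: "p \<in> B" using pM by (auto simp: bounded_seqs_def)
    show "\<exists>P\<in>N. \<forall>Z\<in>N. (e Z P)\<^sup>2 \<le> (1 - l) * (e Z X)\<^sup>2 + l * (e Z Y)\<^sup>2 - l * (1 - l) * (e X Y)\<^sup>2"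
    proof (intro bexI[OF _ class_mem[OF pB]] ballI)
      fix Z assume "Z \<in> N"
      then obtain z where z: "z \<in> B" "Z = class z" by (meson class_cases)
      show "(e Z (class p))\<^sup>2 \<le> (1 - l) * (e Z X)\<^sup>2 + l * (e Z Y)\<^sup>2 - l * (1 - l) * (e X Y)\<^sup>2"
        unfolding xy z
      proof (rule tendsto_le[OF nontrivial])
        show "((\<lambda>n. (1 - l) * (d (z n) (x n))\<^sup>2 + l * (d (z n) (y n))\<^sup>2 - l * (1 - l) * (d (x n) (y n))\<^sup>2) \<longlongrightarrow>
          (1 - l) * (e (class z) (class x))\<^sup>2 + l * (e (class z) (class y))\<^sup>2
            - l * (1 - l) * (e (class x) (class y))\<^sup>2) \<omega>"
          using z(1) xy(1,2) by (intro tendsto_intros tendsto_ultra_dist)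
        show "((\<lambda>n. (d (z n) (p n))\<^sup>2) \<longlongrightarrow> (e (class z) (class p))\<^sup>2) \<omega>"
          using z(1) pB by (intro tendsto_intros tendsto_ultra_dist)
      qed (use p seq_mem z(1) in auto)
    qed
  qed
qed

sublocale U: hadamard N e by (rule hadamard_ultra)

section \<open>Boundary points and rays under the canonical embedding\<close>

abbreviation "bmap \<equiv> boundary_map N e emb"

lemma emb_eq: "emb x = class (\<lambda>_. x)"
  by (simp add: ultra_embed_def)

lemma emb_mem: "x \<in> M \<Longrightarrow> emb x \<in> N"
  using class_mem const_seq by (simp add: emb_eq)

lemma emb_dist: "x \<in> M \<Longrightarrow> y \<in> M \<Longrightarrow> e (emb x) (emb y) = d x y"
  unfolding emb_eq by (intro ultra_dist_eqI const_seq tendsto_const)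

lemma asymptotic_emb:
  assumes "(r, r') \<in> asymptotic M d"
  shows "(restrict (emb \<circ> r) {0..}, restrict (emb \<circ> r') {0..}) \<in> asymptotic N e"
proof -
  have r: "r \<in> rays M d" "r' \<in> rays M d" using assms asymptotic_raysD by auto
  have "restrict (emb \<circ> u) {0..} \<in> rays N e" if "u \<in> rays M d" for u
    using that rays_mem[of u M d] rays_dist[of u M d] emb_mem emb_dist by (auto simp: rays_def)
  moreover obtain C where "\<And>t. 0 \<le> t \<Longrightarrow> d (r t) (r' t) \<le> C"
    using assms by (auto simp: asymptotic_def)
  then have "\<And>t. 0 \<le> t \<Longrightarrow> e (emb (r t)) (emb (r' t)) \<le> C"
    using r rays_mem emb_dist by metis
  ultimately show ?thesis
    using r by (auto simp: asymptotic_def)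
qed

lemma boundary_map_eq:
  assumes \<xi>: "\<xi> \<in> boundary M d" and r: "r \<in> \<xi>"
  shows "bmap \<xi> = asymptotic N e `` {restrict (emb \<circ> r) {0..}}"
proof -
  have "asymptotic N e `` {restrict (emb \<circ> r') {0..}} = asymptotic N e `` {restrict (emb \<circ> r) {0..}}"
    if "r' \<in> \<xi>" for r'
    using equiv_class_eq[OF U.equiv_asymptotic asymptotic_emb] boundary_asymptotic[OF \<xi> that r] by blast
  then show ?thesis
    unfolding boundary_map_def using r by blast
qed

lemma boundary_map_mem:
  assumes "\<xi> \<in> boundary M d"
  shows "bmap \<xi> \<in> boundary N e"
proof -
  have r: "ray_from b \<xi> \<in> \<xi>" using ray_from assms base by blast
  then have "restrict (emb \<circ> ray_from b \<xi>) {0..} \<in> rays N e"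
    using asymptotic_emb[OF boundary_asymptotic[OF assms r r]] asymptotic_raysD by blast
  then show ?thesis
    unfolding boundary_map_eq[OF assms r] boundary_def by (rule quotientI)
qed

text \<open>The image of the ray lies in the class \<open>bmap \<xi>\<close> and starts at
  \<open>emb x\<close>, so uniqueness identifies it.\<close>

lemma ray_from_boundary_map:
  assumes "\<xi> \<in> boundary M d" "x \<in> M" "0 \<le> t"
  shows "ray_from (emb x) (bmap \<xi>) t = emb (ray_from x \<xi> t)"
proof -
  let ?r = "restrict (emb \<circ> ray_from x \<xi>) {0..}"
  have r: "ray_from x \<xi> \<in> \<xi>" "ray_from x \<xi> 0 = x" using ray_from assms by auto
  have "?r \<in> bmap \<xi>"
    unfolding boundary_map_eq[OF assms(1) r(1)]
    using asymptotic_emb[OF boundary_asymptotic[OF assms(1) r(1) r(1)]] by blast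
  then have "ray_from (emb x) (bmap \<xi>) = ?r"
    using U.ray_from_eqI[OF boundary_map_mem[OF assms(1)]] r(2) by simp
  then show ?thesis using assms(3) by simp
qed

text \<open>For fixed \<open>t\<close> the points at distance \<open>t\<close> from \<open>b\<close>
  on the segments to \<open>x k\<close> represent a point of the ultralimit. The segments become
  arbitrarily long, so for \<open>\<omega>\<close>-almost all \<open>k\<close> two such points have
  distance exactly \<open>\<bar>s - t\<bar>\<close>.\<close>

lemma radial_ray_exists:
  assumes x: "\<And>k. x k \<in> M" and inf: "filterlim (\<lambda>k. d b (x k)) at_top \<omega>"
  obtains p where "\<And>t. p t \<in> B" "restrict (\<lambda>t. class (p t)) {0..} \<in> rays N e" "class (p 0) = emb b"
    "\<And>t k. 0 \<le> t \<Longrightarrow> t \<le> d b (x k) \<Longrightarrow> 0 < d b (x k) \<Longrightarrow> between b (x k) (t / d b (x k)) (p t k)"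
proof -
  \<comment> \<open>The default \<open>b\<close> is taken where the segment is too short or
    \<open>t\<close> is negative; the bound \<open>\<bar>t\<bar>\<close> makes \<open>p t\<close> a
    bounded sequence for every \<open>t\<close>.\<close>
  have "\<exists>q\<in>M. d q b \<le> \<bar>t\<bar> \<and> (0 \<le> t \<longrightarrow> t \<le> d b (x k) \<longrightarrow> 0 < d b (x k) \<longrightarrow> between b (x k) (t / d b (x k)) q)"
    for t k
  proof (cases "0 \<le> t \<and> t \<le> d b (x k) \<and> 0 < d b (x k)")
    case True
    then have "\<exists>q. between b (x k) (t / d b (x k)) q"
      using x base by (intro between_ex) auto
    then obtain q where q: "between b (x k) (t / d b (x k)) q" ..
    then show ?thesis using True by (intro bexI[of _ q]) (auto simp: between_def commute)
  next
    case False
    then show ?thesis using base by (intro bexI[of _ b]) auto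
  qed
  then obtain p where p: "\<And>t k. p t k \<in> M" "\<And>t k. d (p t k) b \<le> \<bar>t\<bar>"
    "\<And>t k. 0 \<le> t \<Longrightarrow> t \<le> d b (x k) \<Longrightarrow> 0 < d b (x k) \<Longrightarrow> between b (x k) (t / d b (x k)) (p t k)"
    by metis
  have pB: "p t \<in> B" for t using p(1) p(2)[of t] by (auto simp: bounded_seqs_def)
  have dist: "e (class (p s)) (class (p t)) = \<bar>s - t\<bar>" if st: "0 \<le> s" "0 \<le> t" for s t
  proof (rule ultra_dist_eqI[OF pB pB tendsto_eventually])
    have "\<forall>\<^sub>F k in \<omega>. 1 + s + t \<le> d b (x k)"
      using inf by (simp add: filterlim_at_top)
    then show "\<forall>\<^sub>F k in \<omega>. d (p s k) (p t k) = \<bar>s - t\<bar>"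
    proof eventually_elim
      case (elim k)
      have pos: "0 < d b (x k)" "s \<le> d b (x k)" "t \<le> d b (x k)" using elim st by auto
      have "d (p s k) (p t k) = \<bar>s / d b (x k) - t / d b (x k)\<bar> * d b (x k)"
        using p(3) pos st x base by (intro between_dist) auto
      also have "\<dots> = \<bar>s - t\<bar>"
        using pos by (simp flip: diff_divide_distrib)
      finally show ?case .
    qed
  qed
  have "d (p 0 k) b \<le> 0" for k using p(2)[of 0 k] by simp
  then have "(\<lambda>k. d (p 0 k) b) = (\<lambda>_. 0)" by (intro ext antisym) auto
  then have "class (p 0) = emb b"
    unfolding emb_eq class_eq_iff[OF pB const_seq[OF base]] by simp
  moreover have "restrict (\<lambda>t. class (p t)) {0..} \<in> rays N e"
    using dist class_mem pB by (auto simp: rays_def)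
  ultimately show ?thesis using that[of p] pB p(3) by blast
qed

text \<open>For fixed \<open>s\<close> and \<open>t\<close> and \<open>\<omega>\<close>-almost all
  \<open>k\<close> both lie below \<open>d b (x k)\<close>, and monotonicity compares the cosine at
  \<open>s\<close>, \<open>t\<close> with the one at distance \<open>d b (x k)\<close>. The limit in
  \<open>k\<close> is taken first; \<open>cos_tits_angle_ge\<close> then covers all \<open>s\<close>
  and \<open>t\<close>.\<close>

lemma radial_boundary_point:
  assumes x: "\<And>k. x k \<in> M" and inf: "filterlim (\<lambda>k. d b (x k)) at_top \<omega>"
  obtains \<eta> where "\<eta> \<in> boundary N e"
    "\<And>\<xi> K. \<xi> \<in> boundary M d \<Longrightarrow>
      ((\<lambda>k. comparison_cos d b (ray_from b \<xi> (d b (x k))) (x k)) \<longlongrightarrow> K) \<omega> \<Longrightarrow>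
      K \<le> cos (tits_angle N e (bmap \<xi>) \<eta>)"
proof -
  obtain p where p: "\<And>t. p t \<in> B" "restrict (\<lambda>t. class (p t)) {0..} \<in> rays N e" "class (p 0) = emb b"
    "\<And>t k. 0 \<le> t \<Longrightarrow> t \<le> d b (x k) \<Longrightarrow> 0 < d b (x k) \<Longrightarrow> between b (x k) (t / d b (x k)) (p t k)"
    using radial_ray_exists[OF assms] by metis
  define \<rho> where "\<rho> = restrict (\<lambda>t. class (p t)) {0..}"
  define \<eta> where "\<eta> = asymptotic N e `` {\<rho>}"
  have \<eta>: "\<eta> \<in> boundary N e"
    unfolding \<eta>_def boundary_def \<rho>_def using p(2) by (rule quotientI)
  have "\<rho> \<in> \<eta>"
    unfolding \<eta>_def using equiv_class_self[OF U.equiv_asymptotic] p(2) by (simp add: \<rho>_def)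
  then have \<rho>: "ray_from (emb b) \<eta> t = class (p t)" if "0 \<le> t" for t
    using U.ray_from_eqI[OF \<eta>] p(3) that by (simp add: \<rho>_def)
  have "K \<le> cos (tits_angle N e (bmap \<xi>) \<eta>)"
    if \<xi>: "\<xi> \<in> boundary M d"
      and K: "((\<lambda>k. comparison_cos d b (ray_from b \<xi> (d b (x k))) (x k)) \<longlongrightarrow> K) \<omega>" for \<xi> K
  proof (rule U.cos_tits_angle_ge[OF boundary_map_mem[OF \<xi>] \<eta> emb_mem[OF base]])
    fix s t :: real assume st: "0 < s" "0 < t"
    define q where "q = ray_from b \<xi> s"
    have q: "q \<in> M" using ray_from_mem \<xi> base st by (simp add: q_def)
    have "emb b \<noteq> class (p t)" "b \<noteq> q"
    proof -
      have "e (emb b) (class (p t)) = t"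
        using U.ray_from_dist_start[OF \<eta> emb_mem[OF base], of t] \<rho> st by simp
      then show "emb b \<noteq> class (p t)" using st class_mem p(1) by auto
      have "d b q = s"
        unfolding q_def using ray_from_dist_start \<xi> base st by simp
      then show "b \<noteq> q" using st base by auto
    qed
    \<comment> \<open>The limit of the quotients needs a denominator with nonzero limit.\<close>
    then have nz: "2 * e (class (\<lambda>_. b)) (class (\<lambda>_. q)) * e (class (\<lambda>_. b)) (class (p t)) \<noteq> 0"
      using U.zero[OF emb_mem[OF base] emb_mem[OF q]] U.zero[OF emb_mem[OF base] class_mem[OF p(1)]]
        emb_dist[OF base q] base q by (simp add: emb_eq)
    have "((\<lambda>k. comparison_cos d b q (p t k)) \<longlongrightarrow> comparison_cos e (class (\<lambda>_. b)) (class (\<lambda>_. q)) (class (p t))) \<omega>"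
      unfolding comparison_cos_def using nz base q p(1)
      by (intro tendsto_intros tendsto_ultra_dist[of "\<lambda>_. b" "\<lambda>_. q"] tendsto_ultra_dist[of "\<lambda>_. b"]
          tendsto_ultra_dist[of "\<lambda>_. q"] const_seq)
    moreover have "\<forall>\<^sub>F k in \<omega>. 1 + s + t \<le> d b (x k)"
      using inf by (simp add: filterlim_at_top)
    then have "\<forall>\<^sub>F k in \<omega>. comparison_cos d b (ray_from b \<xi> (d b (x k))) (x k) \<le> comparison_cos d b q (p t k)"
    proof eventually_elim
      case (elim k)
      have pos: "0 < d b (x k)" "s \<le> d b (x k)" "t \<le> d b (x k)" using elim st by auto
      have "d b (ray_from b \<xi> (d b (x k))) = d b (x k)"
        using ray_from_dist_start \<xi> base by simp
      then have ne: "b \<noteq> ray_from b \<xi> (d b (x k))" using pos base by auto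
      show ?case
      proof (rule comparison_cos_antimono)
        show "between b (ray_from b \<xi> (d b (x k))) (s / d b (x k)) q"
          unfolding q_def using \<xi> base st pos by (intro ray_from_between) auto
        show "between b (x k) (t / d b (x k)) (p t k)"
          using p(4) st pos by simp
      qed (use base x \<xi> ne pos st ray_from_mem in auto)
    qed
    ultimately have "K \<le> comparison_cos e (emb b) (emb q) (class (p t))"
      unfolding emb_eq by (intro tendsto_le[OF nontrivial _ K])
    then show "K \<le> comparison_cos e (emb b) (ray_from (emb b) (bmap \<xi>) s) (ray_from (emb b) \<eta> t)"
      using st ray_from_boundary_map[OF \<xi> base, of s] \<rho>[of t] by (simp add: q_def)
  qed
  with \<eta> show ?thesis by (rule that)
qed

text \<open>The quadratic terms \<open>(D k)\<^sup>2\<close> cancel, and division by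
  \<open>2 * D k\<close> bounds the weighted sum of cosines below by a null sequence. Positive
  weights carry the limit over to the Tits angles term by term.\<close>

lemma slope_ultra_nonpos:
  assumes c: "weighted_config M d c"
    and x: "\<And>k. x k \<in> M" "\<And>k. real k \<le> d b (x k)"
      "\<And>k. d b (x k) \<le> d b (weak_contraction c (x k))"
  shows "\<exists>\<eta>\<in>boundary N e. slope N e (ultra_config M d b \<omega> c) \<eta> \<le> 0"
proof -
  define D where "D k = d b (x k)" for k
  define L where "L = (\<Sum>z\<leftarrow>c. snd z)"
  define C where "C = (\<Sum>z\<leftarrow>c. (snd z)\<^sup>2 + 7 * L * snd z)"
  define h where "h \<xi> k = comparison_cos d b (ray_from b \<xi> (D k)) (x k)" for \<xi> k
  have "filterlim D at_top sequentially"
    using x(2) by (intro filterlim_at_top_mono[OF filterlim_real_sequentially]) (auto simp: D_def)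
  then have inf: "filterlim D at_top \<omega>"
    using nonprincipal_ultrafilter_le_sequentially[OF ultrafilter] by (rule filterlim_mono[OF _ order_refl])
  then have large: "\<forall>\<^sub>F k in \<omega>. a \<le> D k" for a by (simp add: filterlim_at_top)
  have "\<exists>K. (h \<xi> \<longlongrightarrow> K) \<omega>" if \<xi>: "\<xi> \<in> boundary M d" for \<xi>
  proof -
    have "\<forall>\<^sub>F k in \<omega>. \<bar>h \<xi> k\<bar> \<le> 1"
      using large[of 1]
    proof eventually_elim
      case (elim k)
      have "d b (ray_from b \<xi> (D k)) = D k"
        using ray_from_dist_start[OF \<xi> base] elim by simp
      then have "b \<noteq> ray_from b \<xi> (D k)" "b \<noteq> x k" using elim base D_def[of k] by auto
      then have "h \<xi> k \<in> {-1..1}"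
        unfolding h_def using elim ray_from_mem[OF \<xi> base, of "D k"] x(1) base
        by (intro comparison_cos_bounds) auto
      then show ?case by (simp add: abs_le_iff minus_le_iff)
    qed
    then show ?thesis by (rule ultrafilter_tendsto[OF ultrafilter]) blast
  qed
  then obtain K where K: "\<And>\<xi>. \<xi> \<in> boundary M d \<Longrightarrow> (h \<xi> \<longlongrightarrow> K \<xi>) \<omega>" by metis
  obtain \<eta> where \<eta>: "\<eta> \<in> boundary N e"
    "\<And>\<xi> K. \<xi> \<in> boundary M d \<Longrightarrow> (h \<xi> \<longlongrightarrow> K) \<omega> \<Longrightarrow> K \<le> cos (tits_angle N e (bmap \<xi>) \<eta>)"
    using radial_boundary_point[OF x(1) inf[unfolded D_def], folded D_def, folded h_def] by blast
  have cD: "fst z \<in> boundary M d" "0 < snd z" if "z \<in> set c" for z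
    using c that by (auto simp: weighted_config_def)
  have "0 \<le> (\<Sum>z\<leftarrow>c. snd z * K (fst z))"
  proof (rule tendsto_le[OF nontrivial])
    show "((\<lambda>k. \<Sum>z\<leftarrow>c. snd z * h (fst z) k) \<longlongrightarrow> (\<Sum>z\<leftarrow>c. snd z * K (fst z))) \<omega>"
      using K cD by (intro tendsto_sum_list tendsto_intros) auto
    show "((\<lambda>k. - C / 2 / D k) \<longlongrightarrow> 0) \<omega>"
      by (intro tendsto_divide_0[OF tendsto_const] filterlim_at_top_imp_at_infinity inf)
    show "\<forall>\<^sub>F k in \<omega>. - C / 2 / D k \<le> (\<Sum>z\<leftarrow>c. snd z * h (fst z) k)"
      \<comment> \<open>\<open>D k \<ge> 1\<close> permits the division, and
        \<open>D k \<ge> L\<close> the estimate along the composition.\<close>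
      using large[of 1] large[of L]
    proof eventually_elim
      case (elim k)
      have "(d b (weak_contraction c (x k)))\<^sup>2 \<le> (D k)\<^sup>2 + C + 2 * D k * (\<Sum>z\<leftarrow>c. snd z * h (fst z) k)"
        unfolding C_def h_def D_def using elim x(1) base c
        by (intro dist_weak_contraction_le) (auto simp: D_def L_def)
      moreover have "(D k)\<^sup>2 \<le> (d b (weak_contraction c (x k)))\<^sup>2"
        unfolding D_def using x(3) by (intro power_mono) auto
      ultimately have "- C \<le> 2 * D k * (\<Sum>z\<leftarrow>c. snd z * h (fst z) k)" by linarith
      then show ?case using elim by (simp add: field_simps)
    qed
  qed
  also have "\<dots> \<le> (\<Sum>z\<leftarrow>c. snd z * cos (tits_angle N e (bmap (fst z)) \<eta>))"
    using \<eta>(2) K cD by (intro sum_list_mono mult_left_mono) (auto intro: less_imp_le)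
  finally have "slope N e (ultra_config M d b \<omega> c) \<eta> \<le> 0"
    by (simp add: slope_def ultra_config_def o_def case_prod_unfold)
  with \<eta>(1) show ?thesis by blast
qed

end

theorem corollary3p9:
  fixes M :: "'a set" and d :: "'a \<Rightarrow> 'a \<Rightarrow> real" and b :: 'a
    and \<omega> :: "nat filter" and c :: "'a wconfig"
  assumes "Hadamard_space M d"
    and "b \<in> M"
    and "nonprincipal_ultrafilter \<omega>"
    and "weighted_config M d c"
    and "stable_config (ultra_space M d b \<omega>) (ultra_dist M d b \<omega>) (ultra_config M d b \<omega> c)"
  shows "(\<exists>x\<in>M. weak_contraction c x = x) \<and> (\<exists>p. polygon M p \<and> gauss_map d c p)"
proof -
  interpret hadamard M d by (rule hadamard_if_Hadamard_space) (rule assms(1))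
  interpret ultralimit M d b \<omega> by unfold_locales (rule assms)+
  have "\<exists>x\<in>M. weak_contraction c x = x"
  proof (rule ccontr)
    assume "\<not> (\<exists>x\<in>M. weak_contraction c x = x)"
    then obtain x where "\<And>k. x k \<in> M" "\<And>k. real k \<le> d b (x k)"
      "\<And>k. d b (x k) \<le> d b (weak_contraction c (x k))"
      using escaping_sequence[OF assms(4,2)] by metis
    then obtain \<eta> where "\<eta> \<in> boundary N e" "slope N e (ultra_config M d b \<omega> c) \<eta> \<le> 0"
      using slope_ultra_nonpos[OF assms(4)] by blast
    then show False using assms(5) unfolding stable_config_def by force
  qed
  then show ?thesis using fixed_point_polygon[OF assms(4)] by blast
qed

end
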